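(* The implication "(D) $\Rightarrow$ (E)" (conditions (D) and (E), depending on $K$, distinct angles $\theta_1,\dots,\theta_K$ and positive integers $m_1,\dots,m_K$, are defined in the context) is false in general. More precisely, take $$K=2,\qquad (\theta_1,\theta_2)=(0,\pi/2),\qquad (m_1,m_2)=(3,3).$$ For every real $c$ with $0<c<1/2$, let $\alpha=(\alpha_n)_{n\ge 0}$ be the sequence $$\alpha_n=c\,(n+1)^{-3/20}\bigl(1+(-i)^n\bigr),\qquad n\ge 0,$$ and let $\mu$, with $d\mu(\theta)=w(\theta)\frac{d\theta}{2\pi}+d\mu_s$, be the probability measure on the unit circle whose Verblunsky coefficients are $\alpha$. Then there exist complex sequences $\beta^{(1)},\beta^{(2)}$ with $$\alpha=\beta^{(1)}+\beta^{(2)},\qquad (S-1)^3\beta^{(1)}\in\ell^2,\qquad (S+i)^3\beta^{(2)}\in\ell^2,\qquad \beta^{(1)},\beta^{(2)}\in\ell^8$$ (that is, condition (D) holds for these data), whereas $$\int_0^{2\pi}(1-\cos\theta)^3(1-\sin\theta)^3\log w(\theta)\,\frac{d\theta}{2\pi}=-\infty$$ (that is, condition (E) fails for these data).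
   Context: Let $\mu$ be a probability measure on the unit circle with infinite support, with Lebesgue decomposition $d\mu(\theta)=w(\theta)\frac{d\theta}{2\pi}+d\mu_s$, where $\mu_s$ is singular. Its Verblunsky coefficients $\alpha=(\alpha_n)_{n\ge0}$, $|\alpha_n|<1$, are defined by the Szegő recursion $\Phi_{n+1}(z)=z\Phi_n(z)-\overline{\alpha_n}\,\Phi_n^*(z)$, where $\Phi_n$ are the monic orthogonal polynomials of $\mu$, $\Phi_0=1$, and $\Phi_n^*(z)=z^n\overline{\Phi_n(1/\bar z)}$. By Verblunsky's theorem each sequence in the open unit disk is the Verblunsky sequence of exactly one such $\mu$. $S$ denotes the shift $(S\beta)_n=\beta_{n+1}$ on complex sequences indexed by $n\ge0$; $\ell^p$ denotes the space of $p$-summable sequences. Given $K\ge1$, distinct angles $\theta_1,\dots,\theta_K$ and positive integers $m_1,\dots,m_K$, put $H(e^{i\theta})=\prod_{j=1}^K(1-\cos(\theta-\theta_j))^{m_j}$. Condition (E) (entropy condition): $\int_0^{2\pi}H(e^{i\theta})\log w(\theta)\,\frac{d\theta}{2\pi}>-\infty$. Condition (D) (decomposition condition): there exist sequences $\beta^{(1)},\dots,\beta^{(K)}$ with $\alpha=\sum_{j=1}^K\beta^{(j)}$, $(S-e^{-i\theta_j})^{m_j}\beta^{(j)}\in\ell^2$ and $\beta^{(j)}\in\ell^{2m_j+2}$ for each $j$. The integral in (E) is always well defined in $[-\infty,\infty)$. *)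

theory Defs
  imports "HOL-Probability.Probability" "HOL-Computational_Algebra.Polynomial"
begin

section \<open>Measures on the unit circle\<close>

text \<open>The topological support.\<close>

definition measure_support :: "'a::topological_space measure \<Rightarrow> 'a set" where
  "measure_support M = {x. \<forall>U. open U \<longrightarrow> x \<in> U \<longrightarrow> emeasure M U \<noteq> 0}"

text \<open>A measure on the unit circle is encoded as a Borel measure on the complex plane that
  gives no mass to the complement of the circle.\<close>

definition nontrivial_circle_prob :: "complex measure \<Rightarrow> bool" where
  "nontrivial_circle_prob \<mu> \<longleftrightarrow>
     prob_space \<mu> \<and> sets \<mu> = sets borel \<and> emeasure \<mu> (- sphere 0 1) = 0 \<and>
     infinite (measure_support \<mu>)"

text \<open>The measure $d\theta/2\pi$ on the parameter interval; its image under \<^term>\<open>cis\<close> is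
  normalized arc length on the circle.\<close>

definition dtheta :: "real measure" where
  "dtheta = uniform_measure lborel {0..2 * pi}"

definition ac_circle_measure :: "(real \<Rightarrow> real) \<Rightarrow> complex measure" where
  "ac_circle_measure w = distr (density dtheta (\<lambda>\<theta>. ennreal (w \<theta>))) borel cis"

definition lebesgue_decomposition ::
  "complex measure \<Rightarrow> (real \<Rightarrow> real) \<Rightarrow> complex measure \<Rightarrow> bool" where
  "lebesgue_decomposition \<mu> w \<mu>s \<longleftrightarrow>
     w \<in> borel_measurable borel \<and> (\<forall>\<theta>. 0 \<le> w \<theta>) \<and> sets \<mu>s = sets borel \<and>
     (\<forall>A\<in>sets borel. emeasure \<mu> A = emeasure (ac_circle_measure w) A + emeasure \<mu>s A) \<and>
     (\<exists>N\<in>sets borel. emeasure (distr dtheta borel cis) N = 0 \<and> emeasure \<mu>s (- N) = 0)"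

section \<open>Orthogonal polynomials and Verblunsky coefficients\<close>

definition monic_orthogonal_polys :: "complex measure \<Rightarrow> (nat \<Rightarrow> complex poly) \<Rightarrow> bool" where
  "monic_orthogonal_polys \<mu> \<Phi> \<longleftrightarrow>
     (\<forall>n. degree (\<Phi> n) = n \<and> lead_coeff (\<Phi> n) = 1) \<and>
     (\<forall>m n. m \<noteq> n \<longrightarrow> (LINT z|\<mu>. cnj (poly (\<Phi> m) z) * poly (\<Phi> n) z) = 0)"

text \<open>For a polynomial of degree exactly \<open>n\<close> this is the usual
  $\Phi^*(z) = z^n \overline{\Phi(1/\bar z)}$, as the lemma below records.\<close>

definition star_poly :: "complex poly \<Rightarrow> complex poly" where
  "star_poly p = map_poly cnj (reflect_poly p)"

lemma poly_star_poly:
  assumes "z \<noteq> 0"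
  shows "poly (star_poly p) z = z ^ degree p * cnj (poly p (1 / cnj z))"
  using assms by (simp add: star_poly_def poly_reflect_poly_nz divide_inverse)

definition verblunsky :: "complex measure \<Rightarrow> (nat \<Rightarrow> complex) \<Rightarrow> bool" where
  "verblunsky \<mu> \<alpha> \<longleftrightarrow>
     nontrivial_circle_prob \<mu> \<and>
     (\<exists>\<Phi>. monic_orthogonal_polys \<mu> \<Phi> \<and>
        (\<forall>n. \<Phi> (Suc n) = pCons 0 (\<Phi> n) - smult (cnj (\<alpha> n)) (star_poly (\<Phi> n))))"

section \<open>Sequence spaces and the shift\<close>

definition ell :: "nat \<Rightarrow> (nat \<Rightarrow> complex) set" where
  "ell p = {x. summable (\<lambda>n. norm (x n) ^ p)}"

definition shift :: "(nat \<Rightarrow> complex) \<Rightarrow> nat \<Rightarrow> complex" where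
  "shift \<beta> n = \<beta> (Suc n)"

text \<open>The operator $S - z$.\<close>

definition shift_minus :: "complex \<Rightarrow> (nat \<Rightarrow> complex) \<Rightarrow> nat \<Rightarrow> complex" where
  "shift_minus z \<beta> = (\<lambda>n. shift \<beta> n - z * \<beta> n)"

section \<open>The entropy integral\<close>

text \<open>The library's real logarithm has \<open>ln 0 = 0\<close>; here the value at \<open>0\<close> must be \<open>-\<infinity>\<close>.\<close>

definition ext_ln :: "real \<Rightarrow> ereal" where
  "ext_ln x = (if x = 0 then -\<infinity> else ereal (ln x))"

text \<open>Integral of the positive part minus integral of the negative part
  (\<^term>\<open>e2ennreal\<close> sends negative values to \<open>0\<close>).  This is the usual integral whenever one of
  the two is finite.\<close>

definition ext_integral :: "'a measure \<Rightarrow> ('a \<Rightarrow> ereal) \<Rightarrow> ereal" where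
  "ext_integral M f =
     enn2ereal (\<integral>\<^sup>+x. e2ennreal (f x) \<partial>M) - enn2ereal (\<integral>\<^sup>+x. e2ennreal (- f x) \<partial>M)"

text \<open>$\int_0^{2\pi} h(\theta) \log w(\theta)\, d\theta/2\pi$; the convention \<open>0 * -\<infinity> = 0\<close>
  only matters at zeros of \<open>h\<close>.\<close>

definition entropy_integral :: "(real \<Rightarrow> real) \<Rightarrow> (real \<Rightarrow> real) \<Rightarrow> ereal" where
  "entropy_integral h w = ext_integral dtheta (\<lambda>\<theta>. ereal (h \<theta>) * ext_ln (w \<theta>))"

section \<open>The conditions (D) and (E)\<close>

text \<open>Families $\theta_1,\dots,\theta_K$ and $m_1,\dots,m_K$ are functions on \<^typ>\<open>nat\<close>, used
  only on \<open>{1..K}\<close>.  Angles are distinct as points of the circle.\<close>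

definition admissible_data :: "nat \<Rightarrow> (nat \<Rightarrow> real) \<Rightarrow> (nat \<Rightarrow> nat) \<Rightarrow> bool" where
  "admissible_data K \<theta> m \<longleftrightarrow>
     1 \<le> K \<and> inj_on (\<lambda>j. cis (\<theta> j)) {1..K} \<and> (\<forall>j\<in>{1..K}. 1 \<le> m j)"

definition trig_weight :: "nat \<Rightarrow> (nat \<Rightarrow> real) \<Rightarrow> (nat \<Rightarrow> nat) \<Rightarrow> real \<Rightarrow> real" where
  "trig_weight K \<theta> m t = (\<Prod>j=1..K. (1 - cos (t - \<theta> j)) ^ m j)"

definition condition_E :: "nat \<Rightarrow> (nat \<Rightarrow> real) \<Rightarrow> (nat \<Rightarrow> nat) \<Rightarrow> (real \<Rightarrow> real) \<Rightarrow> bool" where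
  "condition_E K \<theta> m w \<longleftrightarrow> entropy_integral (trig_weight K \<theta> m) w > -\<infinity>"

definition condition_D ::
  "nat \<Rightarrow> (nat \<Rightarrow> real) \<Rightarrow> (nat \<Rightarrow> nat) \<Rightarrow> (nat \<Rightarrow> complex) \<Rightarrow> bool" where
  "condition_D K \<theta> m \<alpha> \<longleftrightarrow>
     (\<exists>\<beta> :: nat \<Rightarrow> nat \<Rightarrow> complex.
        (\<forall>n. \<alpha> n = (\<Sum>j=1..K. \<beta> j n)) \<and>
        (\<forall>j\<in>{1..K}. (shift_minus (cis (- \<theta> j)) ^^ m j) (\<beta> j) \<in> ell 2 \<and>
                     \<beta> j \<in> ell (2 * m j + 2)))"

end

theory Submission
  imports Defs "HOL-Complex_Analysis.Complex_Analysis"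
begin

text \<open>
  Let $\varphi_n$ be the orthonormal polynomials of $\mu$.  Since
  $\int |\varphi_n|^2 w\,d\theta/2\pi \le 1$, the inequality $\log x \le x$ for
  $x = w |\varphi_n|^2$ shows that $\int H \log |\varphi_n|^2$ is bounded in $n$ if
  $\int H \log w > -\infty$.  On the circle $H(z) = z^{-6} W(z)$ for a polynomial $W$ of degree 12,
  and $\varphi_n^*$ has no zeros in the closed disc, so this integral is read off from the sixth
  Taylor coefficient of $W \log \varphi_n^*$.

  Over a block of four steps the Verblunsky coefficients may be replaced, up to summable errors,
  by $a (1 + (-i)^n)$ with $a$ constant.  By Cayley--Hamilton $\varphi_{4k}^*$ then satisfies a
  three-term recursion in $k$ governed by the four-step transfer matrix, whose trace is
  $1 + (1-i) b z + (1+i) b z^3 + z^4$ with $b = 4 a^2$ and whose determinant is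
  $z^4 (1-b)(1-b/2)^2$.  The increment of the integral comes out as $b^3/4$ modulo $b^4$: the
  resonances at
  frequencies $2\theta_1 - \theta_2$ and $2\theta_2 - \theta_1$, where $H$ does not vanish, open
  gaps of width of order $a^3$.  With $a = c n^{-3/20}$ we have $\sum a^6 = \infty$ and
  $\sum a^8 < \infty$.
\<close>

section \<open>Sequences modulo summable sequences\<close>

text \<open>The sums of b and b^2 over the blocks diverge as well, so no leading-order estimate can
  decide. The integral of H log |phi_n|^2 has two parts: the Taylor coefficient of W log Phi_n^*,
  and the logarithm of the normalization, which is the product of the 1 - |alpha_k|^2. Their terms
  of order b and b^2 cancel exactly and the surplus at order b^3 is positive. Hence the exact
  bookkeeping to third order, with every error summable.

  Only Taylor coefficients at 0 up to the sixth are read off, so this part runs on formal power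
  series, one coefficient at a time, and no uniform estimate on the circle near the gaps is
  required. The coefficients of Phi_n^* itself grow without bound; the calculus is therefore applied
  to quotients over one block.

  A refutation also needs a measure to exist, so the existence half of Verblunsky's theorem and a
  Lebesgue decomposition are proved as well.\<close>

definition l1 :: "(nat \<Rightarrow> complex) \<Rightarrow> bool" where
  "l1 x \<longleftrightarrow> summable (\<lambda>n. norm (x n))"

lemma l1_zero [simp]: "l1 (\<lambda>n. 0)"
  by (simp add: l1_def)

lemma l1_add: "l1 x \<Longrightarrow> l1 y \<Longrightarrow> l1 (\<lambda>n. x n + y n)"
  unfolding l1_def
  by (rule summable_comparison_test'[of "\<lambda>n. norm (x n) + norm (y n)" 0])
     (auto intro: summable_add norm_triangle_ineq)

lemma l1_minus: "l1 x \<Longrightarrow> l1 (\<lambda>n. - x n)"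
  by (simp add: l1_def)

lemma l1_diff: "l1 x \<Longrightarrow> l1 y \<Longrightarrow> l1 (\<lambda>n. x n - y n)"
  using l1_add[of x "\<lambda>n. - y n"] l1_minus[of y] by simp

lemma l1_mult_Bseq:
  assumes "l1 x" "Bseq y"
  shows "l1 (\<lambda>n. x n * y n)"
proof -
  obtain K where K: "\<And>n. norm (y n) \<le> K"
    using assms(2) by (auto simp: Bseq_def)
  show ?thesis
    unfolding l1_def
  proof (rule summable_comparison_test')
    show "summable (\<lambda>n. K * norm (x n))"
      using assms(1) by (simp add: l1_def summable_mult)
    show "norm (norm (x n * y n)) \<le> K * norm (x n)" for n
      using mult_left_mono[OF K[of n], of "norm (x n)"] by (simp add: norm_mult mult.commute)
  qed
qed

lemma l1_Bseq_mult: "Bseq x \<Longrightarrow> l1 y \<Longrightarrow> l1 (\<lambda>n. x n * y n)"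
  using l1_mult_Bseq[of y x] by (simp add: mult.commute)

lemma l1_cmult: "l1 x \<Longrightarrow> l1 (\<lambda>n. c * x n)"
  by (rule l1_Bseq_mult) auto

lemma l1_sum: "(\<And>i. i \<in> I \<Longrightarrow> l1 (x i)) \<Longrightarrow> l1 (\<lambda>n. \<Sum>i\<in>I. x i n)"
  by (induction I rule: infinite_finite_induct) (auto intro: l1_add)

lemma l1_Suc_iff: "l1 (\<lambda>n. x (Suc n)) \<longleftrightarrow> l1 x"
  unfolding l1_def by (rule summable_Suc_iff)

lemma l1_imp_Bseq: "l1 x \<Longrightarrow> Bseq x"
  unfolding l1_def by (rule summable_imp_Bseq[OF summable_norm_cancel])

lemma Bseq_add2: "Bseq x \<Longrightarrow> Bseq y \<Longrightarrow> Bseq (\<lambda>n. x n + y n :: complex)"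
proof -
  assume "Bseq x" "Bseq y"
  then obtain K L where "\<And>n. norm (x n) \<le> K" "\<And>n. norm (y n) \<le> L"
    by (auto simp: Bseq_def)
  then show ?thesis
    by (intro BseqI'[of _ "K + L"]) (metis add_mono norm_triangle_le)
qed

lemma Bseq_sum: "(\<And>i. i \<in> I \<Longrightarrow> Bseq (x i)) \<Longrightarrow> Bseq (\<lambda>n. \<Sum>i\<in>I. x i n :: complex)"
  by (induction I rule: infinite_finite_induct) (auto intro: Bseq_add2)

section \<open>Sequences of bounded variation\<close>

definition bv :: "(nat \<Rightarrow> complex) \<Rightarrow> bool" where
  "bv x \<longleftrightarrow> Bseq x \<and> l1 (\<lambda>n. x (Suc n) - x n)"

lemma bv_const: "bv (\<lambda>n. c)"
  by (simp add: bv_def)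

lemma bv_add: "bv x \<Longrightarrow> bv y \<Longrightarrow> bv (\<lambda>n. x n + y n)"
  using l1_add[of "\<lambda>n. x (Suc n) - x n" "\<lambda>n. y (Suc n) - y n"]
  by (simp add: bv_def add_diff_add Bseq_add2)

lemma bv_mult: "bv x \<Longrightarrow> bv y \<Longrightarrow> bv (\<lambda>n. x n * y n)"
proof -
  assume x: "bv x" and y: "bv y"
  have "Bseq (\<lambda>n. x (Suc n))"
    using x Bseq_Suc_iff[of x] by (simp add: bv_def)
  then have "l1 (\<lambda>n. x (Suc n) * (y (Suc n) - y n) + (x (Suc n) - x n) * y n)"
    using x y by (intro l1_add l1_Bseq_mult l1_mult_Bseq) (auto simp: bv_def)
  moreover have "x (Suc n) * (y (Suc n) - y n) + (x (Suc n) - x n) * y n = x (Suc n) * y (Suc n) - x n * y n" for n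
    by (simp add: algebra_simps)
  ultimately show ?thesis
    using x y by (simp add: bv_def Bseq_mult)
qed

lemma bv_minus: "bv x \<Longrightarrow> bv (\<lambda>n. - x n)"
  using bv_mult[OF bv_const[of "-1"], of x] by simp

lemma bv_diff: "bv x \<Longrightarrow> bv y \<Longrightarrow> bv (\<lambda>n. x n - y n)"
  using bv_add[of x "\<lambda>n. - y n"] bv_minus[of y] by simp

lemma bv_cnj: "bv x \<Longrightarrow> bv (\<lambda>n. cnj (x n))"
  unfolding bv_def l1_def Bseq_def complex_cnj_diff [symmetric] complex_mod_cnj .

lemma bv_sum: "(\<And>i. i \<in> I \<Longrightarrow> bv (x i)) \<Longrightarrow> bv (\<lambda>n. \<Sum>i\<in>I. x i n)"
  by (induction I rule: infinite_finite_induct) (auto intro: bv_add bv_const)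

text \<open>Imposed on each coefficient separately, without uniformity in \<open>j\<close>: only
  finitely many coefficients are ever evaluated.\<close>

definition fps_l1 :: "(nat \<Rightarrow> complex fps) \<Rightarrow> bool" where
  "fps_l1 F \<longleftrightarrow> (\<forall>j. l1 (\<lambda>n. fps_nth (F n) j))"

definition fps_bdd :: "(nat \<Rightarrow> complex fps) \<Rightarrow> bool" where
  "fps_bdd F \<longleftrightarrow> (\<forall>j. Bseq (\<lambda>n. fps_nth (F n) j))"

definition fps_bv :: "(nat \<Rightarrow> complex fps) \<Rightarrow> bool" where
  "fps_bv F \<longleftrightarrow> (\<forall>j. bv (\<lambda>n. fps_nth (F n) j))"

lemma fps_bv_add: "fps_bv F \<Longrightarrow> fps_bv G \<Longrightarrow> fps_bv (\<lambda>n. F n + G n)"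
  by (simp add: fps_bv_def bv_add)

lemma fps_bv_diff: "fps_bv F \<Longrightarrow> fps_bv G \<Longrightarrow> fps_bv (\<lambda>n. F n - G n)"
  by (simp add: fps_bv_def bv_diff)

lemma fps_bv_minus: "fps_bv F \<Longrightarrow> fps_bv (\<lambda>n. - F n)"
  by (simp add: fps_bv_def bv_minus)

lemma fps_bv_mult: "fps_bv F \<Longrightarrow> fps_bv G \<Longrightarrow> fps_bv (\<lambda>n. F n * G n)"
  by (simp add: fps_bv_def fps_mult_nth bv_sum bv_mult)

lemma fps_bv_const: "fps_bv (\<lambda>n. f)"
  by (simp add: fps_bv_def bv_const)

lemma fps_bv_fps_const: "bv x \<Longrightarrow> fps_bv (\<lambda>n. fps_const (x n))"
  unfolding fps_bv_def
proof
  fix j assume "bv x" then show "bv (\<lambda>n. fps_nth (fps_const (x n)) j)"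
    by (cases "j = 0") (auto simp: bv_const)
qed

lemma fps_bv_power: "fps_bv F \<Longrightarrow> fps_bv (\<lambda>n. F n ^ m)"
  by (induction m) (auto intro: fps_bv_mult fps_bv_const)

lemma fps_bv_imp_l1_diff: "fps_bv F \<Longrightarrow> fps_l1 (\<lambda>n. F (Suc n) - F n)"
  by (simp add: fps_bv_def fps_l1_def bv_def)

lemma fps_l1_add: "fps_l1 F \<Longrightarrow> fps_l1 G \<Longrightarrow> fps_l1 (\<lambda>n. F n + G n)"
  by (simp add: fps_l1_def l1_add)

lemma fps_l1_mult_bdd: "fps_l1 F \<Longrightarrow> fps_bdd G \<Longrightarrow> fps_l1 (\<lambda>n. F n * G n)"
  by (simp add: fps_l1_def fps_bdd_def fps_mult_nth l1_sum l1_mult_Bseq)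

lemma fps_inverse_nth_rec:
  fixes f :: "complex fps"
  assumes "fps_nth f 0 = 1" "j > 0"
  shows "fps_nth (inverse f) j = - (\<Sum>i=1..j. fps_nth f i * fps_nth (inverse f) (j - i))"
proof -
  have "f * inverse f = 1"
    using assms by (simp add: inverse_mult_eq_1')
  then have "(\<Sum>i=0..j. fps_nth f i * fps_nth (inverse f) (j - i)) = 0"
    using assms by (metis fps_mult_nth fps_one_nth less_numeral_extra(3))
  then show ?thesis
    using assms(1) sum.atLeast_Suc_atMost[of 0 j "\<lambda>i. fps_nth f i * fps_nth (inverse f) (j - i)"]
    by (simp add: eq_neg_iff_add_eq_0)
qed

text \<open>Sequences are computed modulo summable ones.  As \<open>b ^ 4\<close> is summable, only the
  Taylor polynomial of degree 3 in \<open>b\<close> matters.\<close>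

locale small_scale =
  fixes b :: "nat \<Rightarrow> complex"
  assumes bv_b: "bv b" and b4: "l1 (\<lambda>n. b n ^ 4)"
begin

definition jet :: "(nat \<Rightarrow> complex) \<Rightarrow> complex \<Rightarrow> complex \<Rightarrow> complex \<Rightarrow> complex \<Rightarrow> bool" where
  "jet x c0 c1 c2 c3 \<longleftrightarrow> l1 (\<lambda>n. x n - (c0 + c1 * b n + c2 * b n ^ 2 + c3 * b n ^ 3))"

lemma bv_cubic: "bv (\<lambda>n. c0 + c1 * b n + c2 * b n ^ 2 + c3 * b n ^ 3)"
  unfolding power2_eq_square power3_eq_cube
  by (intro bv_add bv_mult bv_const bv_b)

lemma jet_imp_Bseq: "jet x c0 c1 c2 c3 \<Longrightarrow> Bseq x"
  using Bseq_add2[OF l1_imp_Bseq, of _ "\<lambda>n. c0 + c1 * b n + c2 * b n ^ 2 + c3 * b n ^ 3"]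
    bv_cubic[of c0 c1 c2 c3] by (fastforce simp: jet_def bv_def)

lemma jet_const: "jet (\<lambda>n. c) c 0 0 0"
  by (simp add: jet_def)

lemma jet_add:
  "jet x c0 c1 c2 c3 \<Longrightarrow> jet y d0 d1 d2 d3 \<Longrightarrow>
   jet (\<lambda>n. x n + y n) (c0 + d0) (c1 + d1) (c2 + d2) (c3 + d3)"
  unfolding jet_def by (drule (1) l1_add) (erule back_subst[of l1], simp add: fun_eq_iff algebra_simps)

lemma jet_mult:
  assumes x: "jet x c0 c1 c2 c3" and y: "jet y d0 d1 d2 d3"
  shows "jet (\<lambda>n. x n * y n) (c0 * d0) (c0 * d1 + c1 * d0) (c0 * d2 + c1 * d1 + c2 * d0)
           (c0 * d3 + c1 * d2 + c2 * d1 + c3 * d0)"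
proof -
  define p q where "p = (\<lambda>n. c0 + c1 * b n + c2 * b n ^ 2 + c3 * b n ^ 3)"
    and "q = (\<lambda>n. d0 + d1 * b n + d2 * b n ^ 2 + d3 * b n ^ 3)"
  \<comment> \<open>The part of \<open>p n * q n\<close> of degree at least four in
    \<open>b n\<close>, divided by \<open>b n ^ 4\<close>; the zero cubic term gives it the shape
    required by \<open>bv_cubic\<close>.\<close>
  define r where "r = (\<lambda>n. (c1 * d3 + c2 * d2 + c3 * d1) + (c2 * d3 + c3 * d2) * b n + c3 * d3 * b n ^ 2 + 0 * b n ^ 3)"
  have "Bseq q" "Bseq r"
    unfolding q_def r_def using bv_cubic bv_def by blast+
  then have "l1 (\<lambda>n. x n * (y n - q n) + (x n - p n) * q n + b n ^ 4 * r n)"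
    using l1_Bseq_mult[OF jet_imp_Bseq[OF x], of "\<lambda>n. y n - q n"]
      l1_mult_Bseq[of "\<lambda>n. x n - p n" q] l1_mult_Bseq[OF b4, of r] x y
    unfolding jet_def p_def q_def
    by (intro l1_add) simp_all
  moreover have "x n * (y n - q n) + (x n - p n) * q n + b n ^ 4 * r n =
      x n * y n - (c0 * d0 + (c0 * d1 + c1 * d0) * b n + (c0 * d2 + c1 * d1 + c2 * d0) * b n ^ 2
           + (c0 * d3 + c1 * d2 + c2 * d1 + c3 * d0) * b n ^ 3)" for n
    unfolding p_def q_def r_def by algebra
  ultimately show ?thesis
    unfolding jet_def by (simp only:)
qed

lemma jet_cmult: "jet x c0 c1 c2 c3 \<Longrightarrow> jet (\<lambda>n. c * x n) (c * c0) (c * c1) (c * c2) (c * c3)"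
  using jet_mult[OF jet_const[of c], of x c0 c1 c2 c3] by simp

lemma jet_minus: "jet x c0 c1 c2 c3 \<Longrightarrow> jet (\<lambda>n. - x n) (- c0) (- c1) (- c2) (- c3)"
  using jet_cmult[of x c0 c1 c2 c3 "-1"] by simp

lemma jet_diff:
  "jet x c0 c1 c2 c3 \<Longrightarrow> jet y d0 d1 d2 d3 \<Longrightarrow>
   jet (\<lambda>n. x n - y n) (c0 - d0) (c1 - d1) (c2 - d2) (c3 - d3)"
  using jet_add[OF _ jet_minus] by force

lemma jet_l1: "l1 x \<Longrightarrow> jet x 0 0 0 0"
  by (simp add: jet_def)

lemma jet_eq:
  "jet x c0 c1 c2 c3 \<Longrightarrow> (\<And>n. x n = y n) \<Longrightarrow> c0 = d0 \<Longrightarrow> c1 = d1 \<Longrightarrow> c2 = d2 \<Longrightarrow> c3 = d3 \<Longrightarrow>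
   jet y d0 d1 d2 d3"
  by (simp add: jet_def)

text \<open>As \<open>b\<close> has bounded variation, a polynomial in \<open>b (Suc n)\<close>
  differs summably from the one in \<open>b n\<close>. A recursion for the next block thus yields
  the expansion at the current one.\<close>

lemma jet_Suc_iff: "jet (\<lambda>n. x (Suc n)) c0 c1 c2 c3 \<longleftrightarrow> jet x c0 c1 c2 c3"
proof -
  define p where "p = (\<lambda>n. c0 + c1 * b n + c2 * b n ^ 2 + c3 * b n ^ 3)"
  have d: "l1 (\<lambda>n. p (Suc n) - p n)"
    using bv_cubic unfolding p_def bv_def by blast
  have "l1 (\<lambda>n. x (Suc n) - p n) \<longleftrightarrow> l1 (\<lambda>n. x (Suc n) - p (Suc n))"
    using l1_add[OF _ d, of "\<lambda>n. x (Suc n) - p (Suc n)"] l1_diff[OF _ d, of "\<lambda>n. x (Suc n) - p n"]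
    by auto
  then show ?thesis
    unfolding jet_def using l1_Suc_iff[of "\<lambda>n. x n - p n"] by (simp add: p_def)
qed

end

section \<open>Four-step transfer matrices\<close>

text \<open>The entries \<open>t11\<close> to \<open>t22\<close> form the product of four Szego
  matrices with rows (z, -c i) and (-a i z, 1), acting on Phi and its reversal. Conjugates are
  passed as an independent family \<open>c\<close>, so that the identities make sense in any
  integral domain, in particular for power series.\<close>

definition t11 :: "'a::idom \<Rightarrow> (nat \<Rightarrow> 'a) \<Rightarrow> (nat \<Rightarrow> 'a) \<Rightarrow> 'a" where
  "t11 z a c = (z\<^sup>2 + c 3 * a 2 * z) * (z\<^sup>2 + c 1 * a 0 * z) + (z * c 2 + c 3) * (a 1 * z\<^sup>2 + a 0 * z)"

definition t12 :: "'a::idom \<Rightarrow> (nat \<Rightarrow> 'a) \<Rightarrow> (nat \<Rightarrow> 'a) \<Rightarrow> 'a" where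
  "t12 z a c = - ((z\<^sup>2 + c 3 * a 2 * z) * (z * c 0 + c 1)) - (z * c 2 + c 3) * (a 1 * c 0 * z + 1)"

definition t21 :: "'a::idom \<Rightarrow> (nat \<Rightarrow> 'a) \<Rightarrow> (nat \<Rightarrow> 'a) \<Rightarrow> 'a" where
  "t21 z a c = - ((a 3 * z\<^sup>2 + a 2 * z) * (z\<^sup>2 + c 1 * a 0 * z)) - (a 3 * c 2 * z + 1) * (a 1 * z\<^sup>2 + a 0 * z)"

definition t22 :: "'a::idom \<Rightarrow> (nat \<Rightarrow> 'a) \<Rightarrow> (nat \<Rightarrow> 'a) \<Rightarrow> 'a" where
  "t22 z a c = (a 3 * z\<^sup>2 + a 2 * z) * (z * c 0 + c 1) + (a 3 * c 2 * z + 1) * (a 1 * c 0 * z + 1)"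

lemma szego_four_steps:
  fixes x y :: "nat \<Rightarrow> 'a::idom"
  assumes y: "\<And>i. y (Suc i) = z * y i - c i * x i"
    and x: "\<And>i. x (Suc i) = x i - a i * (z * y i)"
  shows "y 4 = t11 z a c * y 0 + t12 z a c * x 0" "x 4 = t21 z a c * y 0 + t22 z a c * x 0"
proof -
  have y1: "y 1 = z * y 0 - c 0 * x 0" and x1: "x 1 = x 0 - a 0 * (z * y 0)"
    using y[of 0] x[of 0] by simp_all
  have y2: "y 2 = z * y 1 - c 1 * x 1" and x2: "x 2 = x 1 - a 1 * (z * y 1)"
    using y[of 1] x[of 1] by (simp_all add: numeral_2_eq_2)
  have y3: "y 3 = z * y 2 - c 2 * x 2" and x3: "x 3 = x 2 - a 2 * (z * y 2)"
    using y[of 2] x[of 2] by (simp_all add: eval_nat_numeral)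
  have y4: "y 4 = z * y 3 - c 3 * x 3" and x4: "x 4 = x 3 - a 3 * (z * y 3)"
    using y[of 3] x[of 3] by (simp_all add: eval_nat_numeral)
  show "y 4 = t11 z a c * y 0 + t12 z a c * x 0" "x 4 = t21 z a c * y 0 + t22 z a c * x 0"
    unfolding y4 x4 y3 x3 y2 x2 y1 x1 t11_def t12_def t21_def t22_def
    by algebra+
qed

lemma szego_four_steps_trace:
  "t11 z a c + t22 z a c =
     1 + (a 0 * c 3 + a 2 * c 1 + a 3 * c 2 + a 1 * c 0) * z
       + (a 0 * c 1 * (a 2 * c 3) + a 0 * c 2 + a 1 * c 3 + a 3 * c 1 + a 2 * c 0 + a 3 * c 2 * (a 1 * c 0)) * z\<^sup>2
       + (a 0 * c 1 + a 2 * c 3 + a 1 * c 2 + a 3 * c 0) * z ^ 3 + z ^ 4"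
  unfolding t11_def t22_def by algebra

text \<open>A single step has determinant z (1 - a i c i).\<close>

lemma szego_four_steps_det:
  "t11 z a c * t22 z a c - t12 z a c * t21 z a c =
     z ^ 4 * ((1 - a 0 * c 0) * (1 - a 1 * c 1) * (1 - a 2 * c 2) * (1 - a 3 * c 3))"
  unfolding t11_def t12_def t21_def t22_def by algebra

text \<open>Cayley--Hamilton for the first of two consecutive transfer matrices.\<close>

lemma three_term_recursion:
  fixes x0 :: "'a::idom"
  assumes "x1 = t * y0 + u * x0" "y1 = r * y0 + s * x0" "x2 = t' * y1 + u' * x1"
  shows "x2 = (r + u) * x1 - (r * u - s * t) * x0 + ((u' - u) * x1 + (t' - t) * y1)"
  using assms by algebra

section \<open>The Szego recursion on formal power series\<close>

locale szego_fps =
  fixes \<alpha> :: "nat \<Rightarrow> complex" and Y X :: "nat \<Rightarrow> complex fps"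
  assumes Y0: "Y 0 = 1" and X0: "X 0 = 1"
    and Y_Suc: "\<And>n. Y (Suc n) = fps_X * Y n - fps_const (cnj (\<alpha> n)) * X n"
    and X_Suc: "\<And>n. X (Suc n) = X n - fps_const (\<alpha> n) * (fps_X * Y n)"
begin

lemma X_nth_0 [simp]: "fps_nth (X n) 0 = 1"
  by (induction n) (simp_all add: X0 X_Suc)

text \<open>The quotient of Phi_n by its reversal; when |alpha| < 1 it is the expansion of a finite
  Blaschke product. Only the reversal is sure to be invertible, its constant term being 1.\<close>

definition schur :: "nat \<Rightarrow> complex fps" where
  "schur n = Y n * inverse (X n)"

text \<open>Left implicit on purpose: \<open>schur (Suc n)\<close> reappears only behind a factor
  \<open>fps_X\<close>, so each coefficient is a polynomial in lower ones and no division
  enters.\<close>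

lemma schur_Suc:
  "schur (Suc n) = fps_X * schur n - fps_const (cnj (\<alpha> n)) + fps_X * (fps_const (\<alpha> n) * (schur (Suc n) * schur n))"
proof -
  have 1: "X n * inverse (X n) = 1" "X (Suc n) * inverse (X (Suc n)) = 1"
    by (simp_all add: inverse_mult_eq_1')
  define u v where "u = inverse (X n)" and "v = inverse (X (Suc n))"
  show ?thesis
    using 1 Y_Suc[of n] X_Suc[of n]
    unfolding schur_def u_def [symmetric] v_def [symmetric] by algebra
qed

text \<open>Strong induction on the coefficient index, using the triangular form of
  \<open>schur_Suc\<close>. The bound keeps the error of the three-term recursion summable.\<close>

lemma fps_bdd_schur:
  assumes "Bseq \<alpha>"
  shows "fps_bdd schur"
  unfolding fps_bdd_def
proof
  fix j
  show "Bseq (\<lambda>n. fps_nth (schur n) j)"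
  proof (induction j rule: less_induct)
    case (less j)
    have cnj: "Bseq (\<lambda>n. cnj (\<alpha> n))"
      using assms by (simp add: Bseq_def)
    have "Bseq (\<lambda>n. fps_nth (schur (Suc n)) j)"
    proof (cases "j = 0")
      case True
      then show ?thesis
        using cnj Bseq_minus_iff[of "\<lambda>n. cnj (\<alpha> n)"] by (subst schur_Suc) simp
    next
      case False
      have "Bseq (\<lambda>n. fps_nth (schur n) (j - 1)
              + \<alpha> n * (\<Sum>i=0..j-1. fps_nth (schur (Suc n)) i * fps_nth (schur n) (j - 1 - i)))"
        using False less assms
        by (intro Bseq_add2 Bseq_mult Bseq_sum Bseq_Suc_iff[THEN iffD2, of "\<lambda>n. fps_nth (schur n) _"]) auto
      then show ?thesis
        using False by (subst schur_Suc) (simp add: fps_X_mult_nth, simp add: fps_mult_nth)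
    qed
    then show ?case
      by (rule Bseq_Suc_iff[THEN iffD1])
  qed
qed

text \<open>Its logarithm is the increment of log \<open>X\<close> over one block.\<close>

definition ratio :: "nat \<Rightarrow> complex fps" where
  "ratio k = X (4 * Suc k) * inverse (X (4 * k))"

lemma ratio_nth_0 [simp]: "fps_nth (ratio k) 0 = 1"
  by (simp add: ratio_def del: mult_Suc_right)

abbreviation va :: "nat \<Rightarrow> nat \<Rightarrow> complex" where "va k i \<equiv> \<alpha> (4 * k + i)"
abbreviation vc :: "nat \<Rightarrow> nat \<Rightarrow> complex" where "vc k i \<equiv> cnj (\<alpha> (4 * k + i))"

definition block :: "(complex fps \<Rightarrow> (nat \<Rightarrow> complex fps) \<Rightarrow> (nat \<Rightarrow> complex fps) \<Rightarrow> complex fps) \<Rightarrow> nat \<Rightarrow> complex fps" where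
  "block t k = t fps_X (\<lambda>i. fps_const (va k i)) (\<lambda>i. fps_const (vc k i))"

lemma block_step:
  "Y (4 * Suc k) = block t11 k * Y (4 * k) + block t12 k * X (4 * k)"
  "X (4 * Suc k) = block t21 k * Y (4 * k) + block t22 k * X (4 * k)"
  using szego_four_steps[of "\<lambda>i. Y (4 * k + i)" fps_X "\<lambda>i. fps_const (vc k i)" "\<lambda>i. X (4 * k + i)"
      "\<lambda>i. fps_const (va k i)"]
  by (simp_all add: Y_Suc X_Suc block_def add.commute)

definition tr1 :: "nat \<Rightarrow> complex" where
  "tr1 k = va k 0 * vc k 3 + va k 2 * vc k 1 + va k 3 * vc k 2 + va k 1 * vc k 0"
definition tr2 :: "nat \<Rightarrow> complex" where
  "tr2 k = va k 0 * vc k 1 * (va k 2 * vc k 3) + va k 0 * vc k 2 + va k 1 * vc k 3 + va k 3 * vc k 1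
             + va k 2 * vc k 0 + va k 3 * vc k 2 * (va k 1 * vc k 0)"
definition tr3 :: "nat \<Rightarrow> complex" where
  "tr3 k = va k 0 * vc k 1 + va k 2 * vc k 3 + va k 1 * vc k 2 + va k 3 * vc k 0"
definition dt :: "nat \<Rightarrow> complex" where
  "dt k = (1 - va k 0 * vc k 0) * (1 - va k 1 * vc k 1) * (1 - va k 2 * vc k 2) * (1 - va k 3 * vc k 3)"

lemma block_trace:
  "block t11 k + block t22 k = 1 + fps_const (tr1 k) * fps_X + fps_const (tr2 k) * fps_X\<^sup>2
     + fps_const (tr3 k) * fps_X ^ 3 + fps_X ^ 4"
  unfolding block_def szego_four_steps_trace tr1_def tr2_def tr3_def
  by (simp only: fps_const_add [symmetric] fps_const_mult [symmetric])

lemma block_det: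
  "block t11 k * block t22 k - block t12 k * block t21 k = fps_X ^ 4 * fps_const (dt k)"
  unfolding block_def szego_four_steps_det dt_def
  by (simp only: fps_const_sub [symmetric] fps_const_mult [symmetric] fps_const_1_eq_1)

text \<open>The error in the three-term recursion, due to the variation of the coefficients from one
  block to the next.\<close>

definition drift :: "nat \<Rightarrow> complex fps" where
  "drift k = (block t22 (Suc k) - block t22 k) + (block t21 (Suc k) - block t21 k) * schur (4 * Suc k)"

text \<open>The three-term recursion divided by \<open>X (4 * Suc k)\<close>, a Riccati recursion.
  The factor \<open>fps_X ^ 4\<close> in front of the inverse keeps it explicit: coefficient 6
  involves \<open>inverse (ratio k)\<close> only up to index 2.\<close>

lemma ratio_Suc:
  "ratio (Suc k) = 1 + fps_const (tr1 k) * fps_X + fps_const (tr2 k) * fps_X\<^sup>2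
     + fps_const (tr3 k) * fps_X ^ 3 + fps_X ^ 4
     - fps_X ^ 4 * (fps_const (dt k) * inverse (ratio k)) + drift k"
proof -
  have *: "X (4 * Suc (Suc k)) = (block t11 k + block t22 k) * X (4 * Suc k)
      - (block t11 k * block t22 k - block t12 k * block t21 k) * X (4 * k)
      + ((block t22 (Suc k) - block t22 k) * X (4 * Suc k) + (block t21 (Suc k) - block t21 k) * Y (4 * Suc k))"
    by (rule three_term_recursion[OF block_step(2) block_step(1) block_step(2)])
  have 1: "X (4 * Suc k) * inverse (X (4 * Suc k)) = 1"
    by (simp add: inverse_mult_eq_1' del: mult_Suc_right)
  have 2: "inverse (ratio k) = X (4 * k) * inverse (X (4 * Suc k))"
    by (simp add: ratio_def fps_inverse_mult fps_inverse_idempotent del: mult_Suc_right)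
  have "ratio (Suc k) = (block t11 k + block t22 k)
     - (block t11 k * block t22 k - block t12 k * block t21 k) * inverse (ratio k) + drift k"
    using 1 unfolding 2 drift_def schur_def unfolding ratio_def * by algebra
  then show ?thesis
    unfolding block_trace block_det by (simp add: mult.assoc)
qed

end

section \<open>The resonant increment\<close>

lemma l1_imp_bv: "l1 x \<Longrightarrow> bv x"
  using l1_Suc_iff[of x] by (simp add: bv_def l1_imp_Bseq l1_diff)

text \<open>The quadratic is (z - 1)(z - i). On the circle its square is 4 i z^2 (1 - cos t)(1 - sin
  t), whose cube is -64 i z^6 H; this explains the constant \<open>\<i> / 64\<close>.\<close>

definition weight_poly :: "complex poly" where
  "weight_poly = smult (\<i> / 64) ([:\<i>, - 1 - \<i>, 1:] ^ 6)"

lemma weight_poly_eq: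
  "weight_poly = [:- \<i> / 64, 3/32 + 3/32 * \<i>, - 9/16, 35/32 - 35/32 * \<i>, 195/64 * \<i>, - 51/16 - 51/16 * \<i>,
     41/8, - 51/16 + 51/16 * \<i>, - 195/64 * \<i>, 35/32 + 35/32 * \<i>, - 9/16, 3/32 - 3/32 * \<i>, \<i> / 64:]"
proof -
  have 2: "[:\<i>, - 1 - \<i>, 1:]\<^sup>2 = [:-1, 2 - 2 * \<i>, 4 * \<i>, - 2 - 2 * \<i>, 1:]"
    by (simp add: power2_eq_square complex_eq_iff)
  have 4: "[:\<i>, - 1 - \<i>, 1:] ^ 4 = [:1, -4 + 4 * \<i>, -16 * \<i>, 20 + 20 * \<i>, -34, 20 - 20 * \<i>, 16 * \<i>, -4 - 4 * \<i>, 1:]"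
  proof -
    have "[:\<i>, - 1 - \<i>, 1:] ^ 4 = [:\<i>, - 1 - \<i>, 1:]\<^sup>2 * [:\<i>, - 1 - \<i>, 1:]\<^sup>2"
      by (simp flip: power_add)
    also have "\<dots> = [:1, -4 + 4 * \<i>, -16 * \<i>, 20 + 20 * \<i>, -34, 20 - 20 * \<i>, 16 * \<i>, -4 - 4 * \<i>, 1:]"
      unfolding 2 by (simp add: complex_eq_iff)
    finally show ?thesis .
  qed
  have "[:\<i>, - 1 - \<i>, 1:] ^ 6 = [:\<i>, - 1 - \<i>, 1:] ^ 4 * [:\<i>, - 1 - \<i>, 1:]\<^sup>2"
    by (simp flip: power_add)
  also have "\<dots> = [:-1, 6 - 6 * \<i>, 36 * \<i>, -70 - 70 * \<i>, 195, -204 + 204 * \<i>, -328 * \<i>, 204 + 204 * \<i>, -195, 70 - 70 * \<i>, 36 * \<i>, -6 - 6 * \<i>, 1:]"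
    unfolding 4 unfolding 2 by (simp add: complex_eq_iff)
  finally show ?thesis
    unfolding weight_poly_def by (simp only:) (simp add: complex_eq_iff)
qed

text \<open>All that is kept of \<open>\<alpha>\<close> is its shape on a block: the modulation
  (-i)^n has period four, and the amplitude may be frozen at \<open>a k\<close>. The amplitude is
  real but typed complex, so that the calculus of \<open>l1\<close> and \<open>bv\<close>
  applies.\<close>

locale resonant = szego_fps +
  fixes a :: "nat \<Rightarrow> complex"
  assumes a_real: "\<And>k. cnj (a k) = a k"
    and bv_a: "bv a" and a8: "l1 (\<lambda>k. a k ^ 8)"
    and \<alpha>_asymp: "\<And>i. i < 4 \<Longrightarrow> l1 (\<lambda>k. \<alpha> (4 * k + i) - (1 + (- \<i>) ^ i) * a k)"
begin

text \<open>Up to summable errors 4 a^2 is |alpha_{4k}|^2. Trace and determinant contain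
  \<open>\<alpha>\<close> only in products with conjugates, so they become polynomials in this
  quantity.\<close>

sublocale small_scale "\<lambda>k. 4 * a k ^ 2"
proof
  show "bv (\<lambda>k. 4 * a k ^ 2)"
    unfolding power2_eq_square by (intro bv_mult bv_const bv_a)
  show "l1 (\<lambda>k. (4 * a k ^ 2) ^ 4)"
    using l1_cmult[OF a8, of "4 ^ 4"] by (simp add: power_mult_distrib flip: power_mult)
qed

lemma bv_va: "i < 4 \<Longrightarrow> bv (\<lambda>k. va k i)"
  using bv_add[OF l1_imp_bv[OF \<alpha>_asymp[of i]] bv_mult[OF bv_const[of "1 + (- \<i>) ^ i"] bv_a]] by simp

lemma bv_vc: "i < 4 \<Longrightarrow> bv (\<lambda>k. vc k i)"
  by (intro bv_cnj bv_va)

lemma \<alpha>_cnj_asymp: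
  assumes "j < 4"
  shows "l1 (\<lambda>k. vc k j - (1 + \<i> ^ j) * a k)"
proof -
  show ?thesis
    using \<alpha>_asymp[OF assms] unfolding l1_def by (subst complex_mod_cnj [symmetric]) (simp add: a_real)
qed

lemma jet_va_vc:
  assumes "i < 4" "j < 4"
  shows "jet (\<lambda>k. va k i * vc k j) 0 ((1 + (- \<i>) ^ i) * (1 + \<i> ^ j) / 4) 0 0"
proof -
  define p q where "p = 1 + (- \<i>) ^ i" and "q = 1 + \<i> ^ j"
  have "Bseq (\<lambda>k. p * a k)" "Bseq (\<lambda>k. vc k j)"
    using bv_vc[OF assms(2)] bv_mult[OF bv_const bv_a] by (simp_all add: bv_def)
  then have "l1 (\<lambda>k. (va k i - p * a k) * vc k j + p * a k * (vc k j - q * a k))"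
    using \<alpha>_asymp[OF assms(1)] \<alpha>_cnj_asymp[OF assms(2)]
    unfolding p_def q_def by (intro l1_add l1_mult_Bseq l1_Bseq_mult)
  moreover have "(va k i - p * a k) * vc k j + p * a k * (vc k j - q * a k)
      = va k i * vc k j - (0 + p * q / 4 * (4 * a k ^ 2) + 0 * (4 * a k ^ 2) ^ 2 + 0 * (4 * a k ^ 2) ^ 3)" for k
    by (simp add: power2_eq_square algebra_simps)
  ultimately show ?thesis
    unfolding jet_def p_def q_def by (simp only:)
qed

lemma jet_coeffs:
  "jet x c0 c1 c2 c3 \<Longrightarrow> c0 = d0 \<Longrightarrow> c1 = d1 \<Longrightarrow> c2 = d2 \<Longrightarrow> c3 = d3 \<Longrightarrow> jet x d0 d1 d2 d3"
  by simp

lemmas jet_intros = jet_const jet_add jet_diff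

text \<open>The modulation takes the values 2, 1 - i, 0, 1 + i on a block; the zero at index 2
  removes every product involving that index.\<close>

lemma jet_va_vc_values:
  "jet (\<lambda>k. va k 0 * vc k 0) 0 1 0 0" "jet (\<lambda>k. va k 1 * vc k 1) 0 (1/2) 0 0"
  "jet (\<lambda>k. va k 2 * vc k 2) 0 0 0 0" "jet (\<lambda>k. va k 3 * vc k 3) 0 (1/2) 0 0"
  "jet (\<lambda>k. va k 0 * vc k 1) 0 ((1 + \<i>) / 2) 0 0" "jet (\<lambda>k. va k 1 * vc k 0) 0 ((1 - \<i>) / 2) 0 0"
  "jet (\<lambda>k. va k 0 * vc k 3) 0 ((1 - \<i>) / 2) 0 0" "jet (\<lambda>k. va k 3 * vc k 0) 0 ((1 + \<i>) / 2) 0 0"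
  "jet (\<lambda>k. va k 1 * vc k 3) 0 (- \<i> / 2) 0 0" "jet (\<lambda>k. va k 3 * vc k 1) 0 (\<i> / 2) 0 0"
  "jet (\<lambda>k. va k 0 * vc k 2) 0 0 0 0" "jet (\<lambda>k. va k 2 * vc k 0) 0 0 0 0"
  "jet (\<lambda>k. va k 1 * vc k 2) 0 0 0 0" "jet (\<lambda>k. va k 2 * vc k 1) 0 0 0 0"
  "jet (\<lambda>k. va k 3 * vc k 2) 0 0 0 0" "jet (\<lambda>k. va k 2 * vc k 3) 0 0 0 0"
  by (rule jet_coeffs[OF jet_va_vc]; simp add: complex_eq_iff eval_nat_numeral)+

lemma jet_tr1: "jet tr1 0 (1 - \<i>) 0 0"
  unfolding tr1_def [abs_def]
  by (rule jet_coeffs, (rule jet_va_vc_values jet_add)+) (simp_all add: complex_eq_iff)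

text \<open>All summands but two have a factor of index 2; the remaining two carry -i/2 and
  i/2.\<close>

lemma jet_tr2: "jet tr2 0 0 0 0"
  unfolding tr2_def [abs_def]
  by (rule jet_coeffs, (rule jet_va_vc_values jet_add jet_mult)+) (simp_all add: complex_eq_iff)

lemma jet_tr3: "jet tr3 0 (1 + \<i>) 0 0"
  unfolding tr3_def [abs_def]
  by (rule jet_coeffs, (rule jet_va_vc_values jet_add)+) (simp_all add: complex_eq_iff)

lemma jet_dt: "jet dt 1 (-2) (5/4) (-1/4)"
proof -
  have 1: "jet (\<lambda>k. (1 - va k 0 * vc k 0) * (1 - va k 1 * vc k 1)) 1 (-3/2) (1/2) 0"
    by (rule jet_coeffs, (rule jet_va_vc_values jet_const jet_diff jet_mult)+) simp_all
  have 2: "jet (\<lambda>k. (1 - va k 2 * vc k 2) * (1 - va k 3 * vc k 3)) 1 (-1/2) 0 0"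
    by (rule jet_coeffs, (rule jet_va_vc_values jet_const jet_diff jet_mult)+) simp_all
  show ?thesis
    unfolding dt_def [abs_def]
    by (rule jet_eq[OF jet_mult[OF 1 2]]) (simp_all add: mult.assoc)
qed

lemma Bseq_\<alpha>: "Bseq \<alpha>"
proof -
  have "\<exists>K. \<forall>k. norm (va k i) \<le> K" if "i < 4" for i
    using bv_va[OF that] by (auto simp: bv_def Bseq_def)
  then obtain K where K: "\<And>i k. i < 4 \<Longrightarrow> norm (va k i) \<le> K i"
    by metis
  have "norm (\<alpha> n) \<le> K 0 + K 1 + K 2 + K 3" for n
  proof -
    have pos: "K i \<ge> 0" if "i < 4" for i
      using K[OF that, of 0] norm_ge_zero order_trans by blast
    have "n mod 4 \<in> {0, 1, 2, 3}" by auto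
    moreover have "norm (\<alpha> n) \<le> K (n mod 4)"
      using K[of "n mod 4" "n div 4"] by simp
    ultimately show ?thesis
      using pos[of 0] pos[of 1] pos[of 2] pos[of 3] by auto
  qed
  then show ?thesis by (rule BseqI')
qed

text \<open>The block entries are polynomials in sequences of bounded variation, so their increments
  are coefficientwise summable, and the bounded factor \<open>schur\<close> preserves this.\<close>

lemma fps_l1_drift: "fps_l1 drift"
proof -
  have "fps_bv (block t22)" "fps_bv (block t21)"
    unfolding block_def t22_def t21_def
    by (intro fps_bv_add fps_bv_diff fps_bv_minus fps_bv_mult fps_bv_power fps_bv_const fps_bv_fps_const
        bv_va bv_vc; simp)+
  moreover have "fps_bdd (\<lambda>k. schur (4 * Suc k))"
    using fps_bdd_schur[OF Bseq_\<alpha>] by (auto simp: fps_bdd_def intro: Bseq_subseq)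
  ultimately show ?thesis
    unfolding drift_def by (intro fps_l1_add fps_l1_mult_bdd fps_bv_imp_l1_diff)
qed

abbreviation rc :: "nat \<Rightarrow> nat \<Rightarrow> complex" where "rc j k \<equiv> fps_nth (ratio k) j"
abbreviation ri :: "nat \<Rightarrow> nat \<Rightarrow> complex" where "ri j k \<equiv> fps_nth (inverse (ratio k)) j"

text \<open>The drift is summable and the index shift is absorbed by \<open>jet_Suc_iff\<close>, so
  the expansions follow directly in increasing order of \<open>j\<close>; no fixed-point equation
  has to be solved.\<close>

lemma jet_ratio_Suc:
  assumes "jet (\<lambda>k. fps_nth (1 + fps_const (tr1 k) * fps_X + fps_const (tr2 k) * fps_X\<^sup>2
     + fps_const (tr3 k) * fps_X ^ 3 + fps_X ^ 4
     - fps_X ^ 4 * (fps_const (dt k) * inverse (ratio k))) j) c0 c1 c2 c3"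
  shows "jet (rc j) c0 c1 c2 c3"
proof -
  have "jet (\<lambda>k. fps_nth (drift k) j) 0 0 0 0"
    using fps_l1_drift by (intro jet_l1) (simp add: fps_l1_def)
  from jet_add[OF assms this] have "jet (\<lambda>k. rc j (Suc k)) c0 c1 c2 c3"
    by (subst ratio_Suc) simp
  then show ?thesis
    by (rule jet_Suc_iff[THEN iffD1])
qed

lemma jet_rc1: "jet (rc 1) 0 (1 - \<i>) 0 0"
  using jet_tr1 by (intro jet_ratio_Suc) (simp add: fps_X_power_mult_nth)

lemma jet_rc2: "jet (rc 2) 0 0 0 0"
  using jet_tr2 by (intro jet_ratio_Suc) (simp add: fps_X_power_mult_nth)

lemma jet_rc3: "jet (rc 3) 0 (1 + \<i>) 0 0"
  using jet_tr3 by (intro jet_ratio_Suc) (simp add: fps_X_power_mult_nth)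

lemma ri_rec: "ri 0 k = 1" "ri 1 k = - rc 1 k" "ri 2 k = rc 1 k * rc 1 k - rc 2 k"
  by (simp_all add: fps_inverse_nth_rec eval_nat_numeral algebra_simps)

text \<open>The determinant enters from this index on. The z^4 term of the trace cancels its
  constant term, as it must: the ratio is 1 when \<open>\<alpha>\<close> vanishes.\<close>

lemma jet_rc4: "jet (rc 4) 0 2 (-5/4) (1/4)"
  using jet_diff[OF jet_const[of 1] jet_dt]
  by (intro jet_ratio_Suc) (simp add: fps_X_power_mult_nth ri_rec)

lemma jet_rc5: "jet (rc 5) 0 (1 - \<i>) (2 * \<i> - 2) ((5 - 5 * \<i>) / 4)"
  using jet_mult[OF jet_dt jet_rc1]
  by (intro jet_ratio_Suc) (simp add: fps_X_power_mult_nth ri_rec[unfolded One_nat_def])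

lemma jet_rc6: "jet (rc 6) 0 0 (2 * \<i>) (-4 * \<i>)"
proof -
  have "jet (\<lambda>k. rc 1 k * rc 1 k - rc 2 k) 0 0 (- 2 * \<i>) 0"
    by (rule jet_coeffs[OF jet_diff[OF jet_mult[OF jet_rc1 jet_rc1] jet_rc2]]) (simp_all add: complex_eq_iff)
  from jet_minus[OF jet_mult[OF jet_dt this]]
  have "jet (\<lambda>k. - (dt k * (rc 1 k * rc 1 k - rc 2 k))) 0 0 (2 * \<i>) (-4 * \<i>)"
    by (rule jet_coeffs) simp_all
  then show ?thesis
    by (intro jet_ratio_Suc) (simp add: fps_X_power_mult_nth ri_rec[unfolded One_nat_def])
qed

text \<open>Coefficient \<open>j\<close> is \<open>j + 1\<close> times coefficient
  \<open>j + 1\<close> of the logarithm of \<open>ratio k\<close>. That logarithm has no constant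
  term, so the indices 0 to 5 determine the sixth coefficient of its product with the
  weight.\<close>

definition logder :: "nat \<Rightarrow> complex fps" where
  "logder k = fps_deriv (ratio k) * inverse (ratio k)"

abbreviation lc :: "nat \<Rightarrow> nat \<Rightarrow> complex" where "lc j k \<equiv> fps_nth (logder k) j"

text \<open>Newton's identities, obtained by comparing coefficients in
  \<open>logder k * ratio k = fps_deriv (ratio k)\<close>.\<close>

lemma logder_rec: "lc j k = of_nat (Suc j) * rc (Suc j) k - (\<Sum>i<j. lc i k * rc (j - i) k)"
proof -
  have "logder k * ratio k = fps_deriv (ratio k)"
    unfolding logder_def using inverse_mult_eq_1[of "ratio k"] by (simp add: mult.assoc)
  then have "(\<Sum>i=0..j. lc i k * rc (j - i) k) = of_nat (Suc j) * rc (Suc j) k"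
    by (metis fps_deriv_nth fps_mult_nth Suc_eq_plus1)
  moreover have "(\<Sum>i=0..j. lc i k * rc (j - i) k) = (\<Sum>i<j. lc i k * rc (j - i) k) + lc j k"
    by (simp add: atLeast0AtMost flip: lessThan_Suc_atMost)
  ultimately show ?thesis by (simp add: algebra_simps)
qed

lemma logder_rec_numeral:
  "lc 0 k = rc 1 k"
  "lc 1 k = 2 * rc 2 k - lc 0 k * rc 1 k"
  "lc 2 k = 3 * rc 3 k - (lc 0 k * rc 2 k + lc 1 k * rc 1 k)"
  "lc 3 k = 4 * rc 4 k - (lc 0 k * rc 3 k + lc 1 k * rc 2 k + lc 2 k * rc 1 k)"
  "lc 4 k = 5 * rc 5 k - (lc 0 k * rc 4 k + lc 1 k * rc 3 k + lc 2 k * rc 2 k + lc 3 k * rc 1 k)"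
  "lc 5 k = 6 * rc 6 k - (lc 0 k * rc 5 k + lc 1 k * rc 4 k + lc 2 k * rc 3 k + lc 3 k * rc 2 k + lc 4 k * rc 1 k)"
  by (rule trans[OF logder_rec], simp add: eval_nat_numeral)+

lemma jet_lc0: "jet (lc 0) 0 (1 - \<i>) 0 0"
  by (rule jet_eq[OF jet_rc1]) (simp_all add: logder_rec_numeral)

lemma jet_lc1: "jet (lc 1) 0 0 (2 * \<i>) 0"
proof -
  have "jet (\<lambda>k. 2 * rc 2 k - lc 0 k * rc 1 k) 0 0 (2 * \<i>) 0"
    by (rule jet_coeffs, ((rule jet_intros jet_rc1 jet_rc2 jet_lc0 jet_mult)+)[1]) (simp_all add: complex_eq_iff)
  then show ?thesis
    by (simp only: logder_rec_numeral(2) [symmetric])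
qed

lemma jet_lc2: "jet (lc 2) 0 (3 + 3 * \<i>) 0 (-2 - 2 * \<i>)"
proof -
  have "jet (\<lambda>k. 3 * rc 3 k - (lc 0 k * rc 2 k + lc 1 k * rc 1 k)) 0 (3 + 3 * \<i>) 0 (-2 - 2 * \<i>)"
    by (rule jet_coeffs, ((rule jet_intros jet_rc1 jet_rc2 jet_rc3 jet_lc0 jet_lc1 jet_mult)+)[1]) (simp_all add: complex_eq_iff)
  then show ?thesis
    by (simp only: logder_rec_numeral(3) [symmetric])
qed

lemma jet_lc3: "jet (lc 3) 0 8 (-13) 1"
proof -
  have "jet (\<lambda>k. 4 * rc 4 k - (lc 0 k * rc 3 k + lc 1 k * rc 2 k + lc 2 k * rc 1 k)) 0 8 (-13) 1"
    by (rule jet_coeffs, ((rule jet_intros jet_rc1 jet_rc2 jet_rc3 jet_rc4 jet_lc0 jet_lc1 jet_lc2 jet_mult)+)[1]) (simp_all add: complex_eq_iff)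
  then show ?thesis
    by (simp only: logder_rec_numeral(4) [symmetric])
qed

lemma jet_lc4: "jet (lc 4) 0 (5 - 5 * \<i>) (-20 + 20 * \<i>) (45/2 - 45/2 * \<i>)"
proof -
  have "jet (\<lambda>k. 5 * rc 5 k - (lc 0 k * rc 4 k + lc 1 k * rc 3 k + lc 2 k * rc 2 k + lc 3 k * rc 1 k)) 0 (5 - 5 * \<i>) (-20 + 20 * \<i>) (45/2 - 45/2 * \<i>)"
    by (rule jet_coeffs, ((rule jet_intros jet_rc1 jet_rc2 jet_rc3 jet_rc4 jet_rc5 jet_lc0 jet_lc1 jet_lc2 jet_lc3 jet_mult)+)[1]) (simp_all add: complex_eq_iff)
  then show ?thesis
    by (simp only: logder_rec_numeral(5) [symmetric])
qed

lemma jet_lc5: "jet (lc 5) 0 0 (18 * \<i>) (- 72 * \<i>)"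
proof -
  have "jet (\<lambda>k. 6 * rc 6 k - (lc 0 k * rc 5 k + lc 1 k * rc 4 k + lc 2 k * rc 3 k + lc 3 k * rc 2 k + lc 4 k * rc 1 k)) 0 0 (18 * \<i>) (- 72 * \<i>)"
    by (rule jet_coeffs, ((rule jet_intros jet_rc1 jet_rc2 jet_rc3 jet_rc4 jet_rc5 jet_rc6 jet_lc0 jet_lc1 jet_lc2 jet_lc3 jet_lc4 jet_mult)+)[1]) (simp_all add: complex_eq_iff)
  then show ?thesis
    by (simp only: logder_rec_numeral(6) [symmetric])
qed

text \<open>The orders b and b^2 are -41/8 times 2 and 3/4, which the normalization will cancel; the
  order b^3 exceeds -41/8 times 5/12 by 1/4.\<close>

lemma jet_log_ratio:
  "jet (\<lambda>k. 2 * fps_nth (fps_of_poly weight_poly * fps_integral0 (logder k)) 6)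
     0 (- 41/4) (- 123/32) (- 181/96)"
proof -
  \<comment> \<open>Coefficient 5 - j of the weight meets \<open>lc j k\<close>, with a factor 2 /
    (j + 1) from the integration.\<close>
  have *: "2 * fps_nth (fps_of_poly weight_poly * fps_integral0 (logder k)) 6 =
     2 * (- 51/16 - 51/16 * \<i>) * lc 0 k + 195/64 * \<i> * lc 1 k + 2/3 * (35/32 - 35/32 * \<i>) * lc 2 k
      + 1/2 * (- 9/16) * lc 3 k + 2/5 * (3/32 + 3/32 * \<i>) * lc 4 k + 1/3 * (- \<i> / 64) * lc 5 k" for k
    by (simp add: weight_poly_eq fps_mult_nth fps_integral_def eval_nat_numeral) (simp add: field_simps)
  show ?thesis
    unfolding *
    by (rule jet_coeffs, ((rule jet_add jet_cmult jet_lc0 jet_lc1 jet_lc2 jet_lc3 jet_lc4 jet_lc5)+)[1])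
       (simp_all add: complex_eq_iff)
qed

end

section \<open>Logarithms of polynomials on the circle\<close>

text \<open>Cauchy's formula for the \<open>k\<close>-th derivative, with the unit circle itself as
  contour; hence the radius beyond 1.\<close>

lemma circle_fourier_coefficient:
  fixes f :: "complex \<Rightarrow> complex"
  assumes "f holomorphic_on ball 0 r" "r > 1" "f has_fps_expansion F"
  shows "((\<lambda>t. f (cis t) * cis (- (real k * t))) has_integral 2 * pi * fps_nth F k) {0..2 * pi}"
proof -
  have sub: "cball 0 1 \<subseteq> ball (0::complex) r" "ball 0 1 \<subseteq> ball (0::complex) r"
    using assms(2) by auto
  have "((\<lambda>u. f u / (u - 0) ^ Suc k) has_contour_integral 2 * pi * \<i> / fact k * (deriv ^^ k) f 0)
          (circlepath 0 1)"
    using assms(1) sub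
    by (intro Cauchy_has_contour_integral_higher_derivative_circlepath)
       (auto intro: holomorphic_on_imp_continuous_on holomorphic_on_subset)
  also have "2 * pi * \<i> / fact k * (deriv ^^ k) f 0 = 2 * pi * \<i> * fps_nth F k"
    by (simp add: fps_nth_fps_expansion[OF assms(3)])
  finally have "((\<lambda>t. f (cis t) / cis t ^ Suc k * \<i> * cis t) has_integral 2 * pi * \<i> * fps_nth F k) {0..2 * pi}"
    unfolding circlepath_def by (subst (asm) has_contour_integral_part_circlepath_iff) auto
  from has_integral_mult_right[OF this, of "- \<i>"]
  have "((\<lambda>t. - \<i> * (f (cis t) / cis t ^ Suc k * \<i> * cis t)) has_integral 2 * pi * fps_nth F k) {0..2 * pi}"
    by (simp add: mult_ac)
  also have "(\<lambda>t. - \<i> * (f (cis t) / cis t ^ Suc k * \<i> * cis t)) = (\<lambda>t. f (cis t) * cis (- (real k * t)))"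
    by (auto simp: fun_eq_iff divide_simps Complex.DeMoivre cis_mult mult_ac simp flip: cis_inverse)
  finally show ?thesis .
qed

lemma poly_zero_free_ball:
  fixes p :: "complex poly"
  assumes "\<And>z. norm z \<le> 1 \<Longrightarrow> poly p z \<noteq> 0"
  obtains r where "r > 1" "\<And>z. z \<in> ball 0 r \<Longrightarrow> poly p z \<noteq> 0"
proof -
  have "open {z. poly p z \<noteq> 0}"
    by (intro open_Collect_neq continuous_intros)
  then obtain e where e: "e > 0" "(\<Union>x\<in>cball 0 1. ball x e) \<subseteq> {z. poly p z \<noteq> 0}"
    using assms by (elim compact_subset_open_imp_ball_epsilon_subset[OF compact_cball, of _ 0 1]) auto
  have "poly p z \<noteq> 0" if z: "z \<in> ball 0 (1 + e)" for z
  proof (cases "norm z \<le> 1")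
    case False
    then have pos: "norm z > 1" by simp
    then have z0: "z \<noteq> 0"
      by (metis norm_zero not_one_less_zero)
    \<comment> \<open>The radial projection of \<open>z\<close> to the circle lies at distance
      \<open>norm z - 1\<close>, which is less than \<open>e\<close>.\<close>
    have "z / norm z - z = of_real (1 / norm z - 1) * z"
      by (simp add: algebra_simps scaleR_conv_of_real divide_inverse)
    then have "dist (z / norm z) z = \<bar>1 / norm z - 1\<bar> * norm z"
      by (simp only: dist_norm norm_mult norm_of_real)
    also have "\<dots> = norm z - 1"
      using pos z0 by (simp add: abs_if field_simps)
    finally have "dist (z / norm z) z = norm z - 1" .
    then have "z \<in> ball (z / norm z) e" "z / norm z \<in> cball 0 1"
      using z z0 by (auto simp: norm_divide)
    then show ?thesis using e by blast
  qed (use assms in auto)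
  then show ?thesis
    using e(1) that[of "1 + e"] by simp
qed

text \<open>The constant term is set to 0 whatever \<open>fps_nth P 0\<close> is, which avoids
  choosing a branch and makes additivity exact.\<close>

definition fps_log :: "complex fps \<Rightarrow> complex fps" where
  "fps_log P = fps_integral0 (fps_deriv P * inverse P)"

lemma fps_log_mult:
  assumes "fps_nth P 0 \<noteq> 0" "fps_nth Q 0 \<noteq> 0"
  shows "fps_log (P * Q) = fps_log P + fps_log Q"
proof -
  have "P * inverse P = 1" "Q * inverse Q = 1"
    using assms by (simp_all add: inverse_mult_eq_1')
  then have "fps_deriv (P * Q) * inverse (P * Q) = fps_deriv P * inverse P + fps_deriv Q * inverse Q"
    by (simp add: fps_inverse_mult) algebra
  then show ?thesis
    by (simp add: fps_log_def fps_integral0_add)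
qed

lemma poly_has_fps_expansion: "poly p has_fps_expansion fps_of_poly (p :: complex poly)"
  by (simp add: has_fps_expansion_def)

text \<open>Differentiating p = exp g gives p' = g' p near 0, so g' expands as p'/p; formal
  integration recovers g up to its value at 0.\<close>

lemma holomorphic_log_has_fps_expansion:
  assumes g: "g holomorphic_on ball 0 r" "r > 0" and eq: "\<And>z. z \<in> ball 0 r \<Longrightarrow> poly p z = exp (g z)"
  shows "g has_fps_expansion fps_log (fps_of_poly p) + fps_const (g 0)"
proof -
  obtain G where G: "g has_fps_expansion G"
    using has_fps_expansion_fps_expansion[of "ball 0 r" g] assms by auto
  have P: "poly p has_fps_expansion fps_of_poly p"
    by (rule poly_has_fps_expansion)
  have p0: "coeff p 0 \<noteq> 0"
    using eq[of 0] g(2) by (simp add: poly_0_coeff_0)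
  have "eventually (\<lambda>z. z \<in> ball 0 r) (nhds (0::complex))"
    using g(2) by (intro eventually_nhds_in_open) auto
  then have "eventually (\<lambda>z. deriv (poly p) z = deriv g z * poly p z) (nhds 0)"
  proof eventually_elim
    case (elim z)
    have "(g has_field_derivative deriv g z) (at z)"
      using g(1) elim holomorphic_derivI open_ball by blast
    then have "((\<lambda>z. exp (g z)) has_field_derivative deriv g z * poly p z) (at z)"
      unfolding eq[OF elim] by (auto intro!: derivative_eq_intros)
    moreover have "\<forall>\<^sub>F w in nhds z. poly p w = exp (g w)"
      using elim eq by (intro eventually_nhds_in_open[of "ball 0 r", THEN eventually_mono]) auto
    ultimately have "(poly p has_field_derivative deriv g z * poly p z) (at z)"
      by (subst DERIV_cong_ev[OF refl _ refl]) auto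
    then show ?case by (rule DERIV_imp_deriv)
  qed
  moreover have "deriv (poly p) has_fps_expansion fps_deriv (fps_of_poly p)"
    using P by (rule has_fps_expansion_deriv)
  ultimately have "(\<lambda>z. deriv g z * poly p z) has_fps_expansion fps_deriv (fps_of_poly p)"
    by (subst has_fps_expansion_cong[OF _ refl, of _ "deriv (poly p)"]) (auto simp: eq_commute elim: eventually_mono)
  moreover have "(\<lambda>z. deriv g z * poly p z) has_fps_expansion fps_deriv G * fps_of_poly p"
    by (intro has_fps_expansion_mult has_fps_expansion_deriv G P)
  ultimately have "fps_deriv G * fps_of_poly p = fps_deriv (fps_of_poly p)"
    using fps_expansion_unique_complex by blast
  then have "fps_deriv G * (fps_of_poly p * inverse (fps_of_poly p)) = fps_deriv (fps_of_poly p) * inverse (fps_of_poly p)"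
    by (metis mult.assoc)
  then have "fps_deriv G = fps_deriv (fps_of_poly p) * inverse (fps_of_poly p)"
    using p0 by (simp add: inverse_mult_eq_1')
  then have "G = fps_log (fps_of_poly p) + fps_const (fps_nth G 0)"
    unfolding fps_log_def by (metis fps_integral0_deriv diff_add_cancel)
  moreover have "fps_nth G 0 = g 0"
    using fps_nth_fps_expansion[OF G, of 0] by simp
  ultimately show ?thesis using G by simp
qed

definition entropy_weight :: "real \<Rightarrow> real" where
  "entropy_weight t = (1 - cos t) ^ 3 * (1 - sin t) ^ 3"

lemma weight_poly_cis: "poly weight_poly (cis t) * cis (- (real 6 * t)) = entropy_weight t"
proof -
  define z where "z = cis t"
  \<comment> \<open>The squared chords from \<open>z\<close> to 1 and to \<open>\<i>\<close> have
    lengths 2 (1 - cos t) and 2 (1 - sin t); the other factors are phases.\<close>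
  have *: "(z - 1)\<^sup>2 = - 2 * z * (1 - cos t)" "(z - \<i>)\<^sup>2 = - 2 * \<i> * z * (1 - sin t)"
    using sin_cos_squared_add3[of t]
    by (simp_all add: z_def complex_eq_iff power2_eq_square algebra_simps)
  have "poly weight_poly z = \<i> / 64 * poly [:\<i>, - 1 - \<i>, 1:] z ^ 6"
    by (simp add: weight_poly_def)
  also have "poly [:\<i>, - 1 - \<i>, 1:] z = (z - 1) * (z - \<i>)"
    by (simp add: algebra_simps)
  also have "((z - 1) * (z - \<i>)) ^ 6 = ((z - 1)\<^sup>2 * (z - \<i>)\<^sup>2) ^ 3"
    by (simp add: power_mult_distrib flip: power_mult)
  also have "(z - 1)\<^sup>2 * (z - \<i>)\<^sup>2 = 4 * \<i> * z\<^sup>2 * ((1 - cos t) * (1 - sin t))"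
    unfolding * by (simp add: power2_eq_square)
  also have "\<i> / 64 * (4 * \<i> * z\<^sup>2 * ((1 - cos t) * (1 - sin t))) ^ 3 = z ^ 6 * entropy_weight t"
    by (simp add: entropy_weight_def power_mult_distrib power3_eq_cube[of \<i>] flip: power_mult)
  also have "z ^ 6 = cis (real 6 * t)"
    unfolding z_def by (subst Complex.DeMoivre) simp
  finally show ?thesis
    by (simp add: z_def cis_mult mult_ac)
qed

text \<open>A polynomial without zeros in the closed disc has a holomorphic logarithm on a larger
  disc. The weight is real, so the real part of its Fourier-type integral contains only ln
  |p|.\<close>

lemma has_integral_weight_log_poly:
  assumes nz: "\<And>z. norm z \<le> 1 \<Longrightarrow> poly p z \<noteq> 0" and p0: "coeff p 0 = 1"
  shows "((\<lambda>t. entropy_weight t * ln (norm (poly p (cis t)))) has_integral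
     2 * pi * Re (fps_nth (fps_of_poly weight_poly * fps_log (fps_of_poly p)) 6)) {0..2 * pi}"
proof -
  obtain r where r: "r > 1" "\<And>z. z \<in> ball 0 r \<Longrightarrow> poly p z \<noteq> 0"
    using poly_zero_free_ball[OF nz] by blast
  have "simply_connected (ball (0::complex) r)"
    by (intro convex_imp_simply_connected) auto
  then have "\<exists>g. g holomorphic_on ball 0 r \<and> (\<forall>z\<in>ball 0 r. poly p z = exp (g z))"
    using simply_connected_eq_holomorphic_log[of "ball 0 r"] r(2) by (blast intro: holomorphic_intros)
  then obtain g where g: "g holomorphic_on ball 0 r" "\<And>z. z \<in> ball 0 r \<Longrightarrow> poly p z = exp (g z)"
    by blast
  have "exp (g 0) = 1"
    using g(2)[of 0] r(1) p0 by (simp add: poly_0_coeff_0)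
  \<comment> \<open>\<open>g 0\<close> is known only as a multiple of 2 pi i; subtracting it leaves
    the real part of \<open>g\<close> unchanged.\<close>
  then have s: "Re (g 0) = 0"
    by (simp add: exp_eq_1)
  have E: "(\<lambda>z. poly weight_poly z * (g z - g 0)) has_fps_expansion
       fps_of_poly weight_poly * (fps_log (fps_of_poly p) + fps_const (g 0) - fps_const (g 0))"
    using r(1)
    by (intro has_fps_expansion_mult has_fps_expansion_diff poly_has_fps_expansion holomorphic_log_has_fps_expansion[OF g(1) _ g(2)]) auto
  have hol: "(\<lambda>z. poly weight_poly z * (g z - g 0)) holomorphic_on ball 0 r"
    by (intro holomorphic_intros g(1))
  have "((\<lambda>t. poly weight_poly (cis t) * (g (cis t) - g 0) * cis (- (real 6 * t))) has_integral
     2 * pi * fps_nth (fps_of_poly weight_poly * fps_log (fps_of_poly p)) 6) {0..2 * pi}"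
    using circle_fourier_coefficient[OF hol r(1) E, of 6] by simp
  also have "(\<lambda>t. poly weight_poly (cis t) * (g (cis t) - g 0) * cis (- (real 6 * t))) =
      (\<lambda>t. entropy_weight t * (g (cis t) - g 0))"
    by (subst weight_poly_cis [symmetric]) (simp add: mult_ac)
  finally have "((\<lambda>t. Re (entropy_weight t * (g (cis t) - g 0))) has_integral
     Re (2 * pi * fps_nth (fps_of_poly weight_poly * fps_log (fps_of_poly p)) 6)) {0..2 * pi}"
    by (rule has_integral_Re)
  also have "(\<lambda>t. Re (entropy_weight t * (g (cis t) - g 0))) = (\<lambda>t. entropy_weight t * ln (norm (poly p (cis t))))"
    using g(2)[of "cis _"] r(1) by (simp add: s fun_eq_iff)
  finally show ?thesis by simp
qed

section \<open>Szego polynomials\<close>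

lemma coeff_star_poly: "coeff (star_poly p) i = (if i \<le> degree p then cnj (coeff p (degree p - i)) else 0)"
  by (simp add: star_poly_def coeff_map_poly coeff_reflect_poly)

lemma degree_star_poly_le: "degree (star_poly p) \<le> degree p"
  by (intro degree_le) (simp add: coeff_star_poly)

text \<open>Built from the coefficients alone, so that the same polynomials serve for an arbitrary
  measure with these coefficients and for the construction of one.\<close>

primrec szego :: "(nat \<Rightarrow> complex) \<Rightarrow> nat \<Rightarrow> complex poly" where
  "szego \<alpha> 0 = 1"
| "szego \<alpha> (Suc n) = pCons 0 (szego \<alpha> n) - smult (cnj (\<alpha> n)) (star_poly (szego \<alpha> n))"

lemma degree_szego [simp]: "degree (szego \<alpha> n) = n"
  and coeff_szego_top [simp]: "coeff (szego \<alpha> n) n = 1"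
proof (induction n)
  case (Suc n)
  have deg: "degree (star_poly (szego \<alpha> n)) \<le> n"
    using degree_star_poly_le[of "szego \<alpha> n"] Suc by simp
  then have 0: "coeff (star_poly (szego \<alpha> n)) (Suc n) = 0"
    by (simp add: coeff_eq_0)
  have 1: "coeff (szego \<alpha> (Suc n)) (Suc n) = 1"
    using Suc 0 by simp
  have "degree (szego \<alpha> (Suc n)) \<le> Suc n"
    using deg Suc degree_smult_le[of "cnj (\<alpha> n)" "star_poly (szego \<alpha> n)"]
    by (auto intro!: degree_diff_le simp: degree_pCons_eq_if)
  then show "degree (szego \<alpha> (Suc n)) = Suc n"
    using 1 by (metis le_antisym le_degree one_neq_zero)
  show "coeff (szego \<alpha> (Suc n)) (Suc n) = 1" by (fact 1)
qed auto

text \<open>\<open>star_poly\<close> reverses with respect to the actual degree;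
  \<open>degree_szego\<close> makes it the reversal of order \<open>n\<close> and of order
  \<open>Suc n\<close> here.\<close>

lemma star_szego_Suc:
  "star_poly (szego \<alpha> (Suc n)) = star_poly (szego \<alpha> n) - smult (\<alpha> n) (pCons 0 (szego \<alpha> n))"
proof (rule poly_eqI)
  fix i
  show "coeff (star_poly (szego \<alpha> (Suc n))) i =
      coeff (star_poly (szego \<alpha> n) - smult (\<alpha> n) (pCons 0 (szego \<alpha> n))) i"
  proof (cases i)
    case 0
    then show ?thesis
      by (simp add: coeff_star_poly[of "szego \<alpha> (Suc n)"] del: szego.simps)
         (simp add: coeff_star_poly)
  next
    case (Suc k)
    consider "k < n" | "k = n" | "k > n" by linarith
    then show ?thesis
    proof cases
      case 1
      then show ?thesis
        unfolding coeff_star_poly[of "szego \<alpha> (Suc n)"] degree_szego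
        by (auto simp: Suc coeff_star_poly coeff_pCons split: nat.splits) (metis Suc_diff_Suc diff_Suc_Suc nat.inject)+
    next
      case 2
      then show ?thesis
        unfolding coeff_star_poly[of "szego \<alpha> (Suc n)"] degree_szego
        by (simp add: Suc coeff_star_poly)
    next
      case 3
      then show ?thesis
        by (simp add: Suc coeff_star_poly[of "szego \<alpha> (Suc n)"] coeff_eq_0 del: szego.simps)
           (simp add: coeff_star_poly)
    qed
  qed
qed

lemma star_szego_0 [simp]: "star_poly 1 = (1 :: complex poly)"
  by (simp add: star_poly_def)

lemma coeff_star_szego_0 [simp]: "coeff (star_poly (szego \<alpha> n)) 0 = 1"
  by (simp add: coeff_star_poly)

lemma szego_fps_szego:
  "szego_fps \<alpha> (\<lambda>n. fps_of_poly (szego \<alpha> n)) (\<lambda>n. fps_of_poly (star_poly (szego \<alpha> n)))"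
proof
  fix n
  show "fps_of_poly (szego \<alpha> (Suc n)) = fps_X * fps_of_poly (szego \<alpha> n)
      - fps_const (cnj (\<alpha> n)) * fps_of_poly (star_poly (szego \<alpha> n))"
    by (simp add: fps_of_poly_diff fps_of_poly_smult fps_of_poly_pCons mult.commute)
  show "fps_of_poly (star_poly (szego \<alpha> (Suc n))) = fps_of_poly (star_poly (szego \<alpha> n))
      - fps_const (\<alpha> n) * (fps_X * fps_of_poly (szego \<alpha> n))"
    unfolding star_szego_Suc by (simp add: fps_of_poly_diff fps_of_poly_smult fps_of_poly_pCons mult.commute)
qed auto

lemma poly_star_szego_circle:
  assumes "norm z = 1"
  shows "poly (star_poly (szego \<alpha> n)) z = z ^ n * cnj (poly (szego \<alpha> n) z)"
proof -
  have "z * cnj z = 1"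
    using assms by (metis complex_norm_square of_real_1 power_one)
  moreover from this have "z \<noteq> 0" "cnj z \<noteq> 0" by auto
  ultimately have "1 / cnj z = z" "z \<noteq> 0"
    by (simp_all add: nonzero_divide_eq_eq)
  then show ?thesis by (simp add: poly_star_poly)
qed

text \<open>The two claims need each other: |z Phi_n| <= |Phi_n^*| and |alpha_n| < 1 keep the next
  reversed polynomial from vanishing, and a Szego step multiplies |x|^2 - |y|^2 by the positive
  number 1 - |alpha_n|^2.\<close>

lemma szego_disc:
  assumes "\<And>k. norm (\<alpha> k) < 1" "norm z \<le> 1"
  shows "norm (poly (szego \<alpha> n) z) \<le> norm (poly (star_poly (szego \<alpha> n)) z)"
    and "poly (star_poly (szego \<alpha> n)) z \<noteq> 0"
proof (induction n)
  case (Suc n)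
  define x y where "x = poly (star_poly (szego \<alpha> n)) z" and "y = z * poly (szego \<alpha> n) z"
  have S: "poly (szego \<alpha> (Suc n)) z = y - cnj (\<alpha> n) * x"
    "poly (star_poly (szego \<alpha> (Suc n))) z = x - \<alpha> n * y"
    unfolding star_szego_Suc by (simp_all add: x_def y_def)
  have yx: "norm y \<le> norm x" "x \<noteq> 0"
    using Suc assms(2) mult_mono[of "norm z" 1 "norm (poly (szego \<alpha> n) z)"]
    by (auto simp: x_def y_def norm_mult)
  have "norm (\<alpha> n * y) < norm x"
  proof -
    have "norm (\<alpha> n * y) \<le> norm (\<alpha> n) * norm x"
      using yx by (simp add: norm_mult mult_left_mono)
    also have "\<dots> < norm x" using assms(1)[of n] yx by simp
    finally show ?thesis .
  qed
  then show "poly (star_poly (szego \<alpha> (Suc n))) z \<noteq> 0"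
    unfolding S by auto
  have "(norm (x - \<alpha> n * y))\<^sup>2 - (norm (y - cnj (\<alpha> n) * x))\<^sup>2 = (1 - (norm (\<alpha> n))\<^sup>2) * ((norm x)\<^sup>2 - (norm y)\<^sup>2)"
    unfolding cmod_power2 by (simp add: algebra_simps power2_eq_square)
  also have "\<dots> \<ge> 0"
    using assms(1)[of n] yx by (intro mult_nonneg_nonneg) (auto simp: power_mono abs_square_le_1 less_imp_le)
  finally show "norm (poly (szego \<alpha> (Suc n)) z) \<le> norm (poly (star_poly (szego \<alpha> (Suc n))) z)"
    unfolding S by (simp add: abs_le_square_iff)
qed auto

lemma norm_szego_circle:
  "norm z = 1 \<Longrightarrow> norm (poly (star_poly (szego \<alpha> n)) z) = norm (poly (szego \<alpha> n) z)"
  by (simp add: poly_star_szego_circle norm_mult norm_power)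

text \<open>The inverse Szego recursion, on which the descending induction for the Bernstein-Szego
  measures rests.\<close>

lemma szego_backward:
  "smult (1 - \<alpha> n * cnj (\<alpha> n)) (pCons 0 (szego \<alpha> n)) =
   szego \<alpha> (Suc n) + smult (cnj (\<alpha> n)) (star_poly (szego \<alpha> (Suc n)))"
  unfolding star_szego_Suc by (simp add: smult_diff_right smult_diff_left algebra_simps)

section \<open>Orthogonality on the circle\<close>

lemma mult_cnj_norm: "1 - z * cnj z = of_real (1 - (norm z)\<^sup>2)"
  using complex_norm_square[of z] by simp

text \<open>Finite rather than of mass one: the total mass of the Bernstein-Szego measures is itself
  found by these lemmas.\<close>

locale circle_measure = finite_measure M for M :: "complex measure" +
  assumes sets_M: "sets M = sets borel" and null_off_circle: "emeasure M (- sphere 0 1) = 0"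
begin

lemma AE_circle: "AE z in M. norm z = 1"
  using null_off_circle by (intro AE_I[of _ _ "- sphere 0 1"]) (auto simp: sets_M)

lemma integrable_continuous:
  fixes f :: "complex \<Rightarrow> complex"
  assumes "continuous_on UNIV f"
  shows "integrable M f"
proof -
  have "bounded (f ` sphere 0 1)"
    using assms by (intro compact_imp_bounded compact_continuous_image)
      (auto intro: continuous_on_subset)
  then obtain B where B: "\<And>z. norm z = 1 \<Longrightarrow> norm (f z) \<le> B"
    unfolding bounded_iff by (metis image_eqI mem_sphere_0)
  show ?thesis
  proof (rule integrable_const_bound)
    show "AE z in M. norm (f z) \<le> B"
      using AE_circle by eventually_elim (rule B)
    show "f \<in> borel_measurable M"
      using borel_measurable_continuous_onI[OF assms] measurable_cong_sets[OF sets_M refl] by blast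
  qed
qed

definition ip :: "complex poly \<Rightarrow> complex poly \<Rightarrow> complex" where
  "ip p q = (LINT z|M. cnj (poly p z) * poly q z)"

lemma integrable_ip: "integrable M (\<lambda>z. cnj (poly p z) * poly q z)"
  by (intro integrable_continuous continuous_intros)

lemma ip_add_right: "ip p (q + r) = ip p q + ip p r"
  unfolding ip_def by (simp add: ring_distribs Bochner_Integration.integral_add[OF integrable_ip integrable_ip])

lemma ip_smult_right: "ip p (smult c q) = c * ip p q"
  unfolding ip_def by (simp add: mult.left_commute)

lemma ip_cnj: "cnj (ip p q) = ip q p"
  unfolding ip_def Bochner_Integration.integral_cnj [symmetric] by (simp add: mult.commute)

lemma ip_add_left: "ip (p + q) r = ip p r + ip q r"
  using ip_add_right[of r p q] ip_cnj by (metis complex_cnj_add)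

lemma ip_smult_left: "ip (smult c p) q = cnj c * ip p q"
  using ip_smult_right[of q c p] ip_cnj by (metis complex_cnj_mult)

lemma ip_0_left [simp]: "ip 0 q = 0"
  by (simp add: ip_def)

lemma ip_cong_circle:
  assumes "\<And>z. norm z = 1 \<Longrightarrow> cnj (poly p z) * poly q z = cnj (poly p' z) * poly q' z"
  shows "ip p q = ip p' q'"
  unfolding ip_def
proof (rule integral_cong_AE)
  show "AE z in M. cnj (poly p z) * poly q z = cnj (poly p' z) * poly q' z"
    using AE_circle by eventually_elim (rule assms)
qed (use integrable_ip in \<open>auto dest: borel_measurable_integrable\<close>)

lemma ip_pCons_pCons: "ip (pCons 0 p) (pCons 0 q) = ip p q"
proof (rule ip_cong_circle)
  fix z :: complex assume "norm z = 1"
  then have "z * cnj z = 1"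
    by (metis complex_norm_square of_real_1 power_one)
  then show "cnj (poly (pCons 0 p) z) * poly (pCons 0 q) z = cnj (poly p z) * poly q z"
    by simp algebra
qed

lemma ip_star_star: "ip (star_poly (szego \<alpha> n)) (star_poly (szego \<alpha> n)) = ip (szego \<alpha> n) (szego \<alpha> n)"
proof (rule ip_cong_circle)
  fix z :: complex assume "norm z = 1"
  then show "cnj (poly (star_poly (szego \<alpha> n)) z) * poly (star_poly (szego \<alpha> n)) z =
    cnj (poly (szego \<alpha> n) z) * poly (szego \<alpha> n) z"
    using norm_szego_circle[of z \<alpha> n] by (metis complex_norm_square mult.commute)
qed

text \<open>Pythagoras for z Phi_n = Phi_{n+1} + conj(alpha_n) Phi_n^*. Multiplication by z
  preserves the norm, reversal does too, and Phi_n^* has degree at most n.\<close>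

lemma ip_szego_Suc:
  assumes "\<And>p. degree p \<le> n \<Longrightarrow> ip p (szego \<alpha> (Suc n)) = 0"
  shows "ip (szego \<alpha> (Suc n)) (szego \<alpha> (Suc n)) = (1 - \<alpha> n * cnj (\<alpha> n)) * ip (szego \<alpha> n) (szego \<alpha> n)"
proof -
  define P Q where "P = szego \<alpha> (Suc n)" and "Q = smult (cnj (\<alpha> n)) (star_poly (szego \<alpha> n))"
  have z: "pCons 0 (szego \<alpha> n) = P + Q"
    by (simp add: P_def Q_def)
  have QP: "ip Q P = 0"
    unfolding P_def using degree_star_poly_le[of "szego \<alpha> n"]
    by (intro assms) (auto simp: Q_def intro: order_trans[OF degree_smult_le])
  then have PQ: "ip P Q = 0"
    using ip_cnj[of Q P] by simp
  have "ip (szego \<alpha> n) (szego \<alpha> n) = ip P P + ip Q Q"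
    using ip_pCons_pCons[of "szego \<alpha> n" "szego \<alpha> n"] PQ QP
    unfolding z by (simp add: ip_add_left ip_add_right)
  also have "ip Q Q = \<alpha> n * cnj (\<alpha> n) * ip (szego \<alpha> n) (szego \<alpha> n)"
    by (simp add: Q_def ip_smult_left ip_smult_right ip_star_star)
  finally have "ip P P = (1 - \<alpha> n * cnj (\<alpha> n)) * ip (szego \<alpha> n) (szego \<alpha> n)"
    by algebra
  then show ?thesis
    by (simp only: P_def)
qed

text \<open>Orthogonality is asked for up to \<open>N\<close> only, which is what a Bernstein-Szego
  measure supplies.\<close>

lemma ip_szego_norm:
  assumes "\<And>n p. n < N \<Longrightarrow> degree p \<le> n \<Longrightarrow> ip p (szego \<alpha> (Suc n)) = 0"
  shows "ip (szego \<alpha> N) (szego \<alpha> N) = of_real (\<Prod>k<N. 1 - (norm (\<alpha> k))\<^sup>2) * ip 1 1"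
  using assms
proof (induction N)
  case (Suc N)
  have "ip (szego \<alpha> (Suc N)) (szego \<alpha> (Suc N)) = of_real (1 - (norm (\<alpha> N))\<^sup>2) * ip (szego \<alpha> N) (szego \<alpha> N)"
    using Suc.prems by (subst ip_szego_Suc) (auto simp: mult_cnj_norm simp del: szego.simps)
  also have "ip (szego \<alpha> N) (szego \<alpha> N) = of_real (\<Prod>k<N. 1 - (norm (\<alpha> k))\<^sup>2) * ip 1 1"
    using Suc.prems by (intro Suc.IH) auto
  finally show ?case by (simp add: mult_ac del: szego.simps)
qed auto

text \<open>Subtracting the leading coefficient times \<open>\<Phi> d\<close> lowers the degree. The
  monic family is arbitrary because it will be the Szego polynomials in one use and the monomials in
  another.\<close>

lemma ip_lower_degree:
  assumes \<Phi>: "\<And>n. degree (\<Phi> n) = n" "\<And>n. coeff (\<Phi> n) n = 1"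
    and orth: "\<And>m. m < n \<Longrightarrow> ip (\<Phi> m) q = 0" and "degree p < n"
  shows "ip p q = 0"
  using \<open>degree p < n\<close>
proof (induction "degree p" arbitrary: p rule: less_induct)
  case less
  define d where "d = degree p"
  define r where "r = p - smult (lead_coeff p) (\<Phi> d)"
  have p: "p = r + smult (lead_coeff p) (\<Phi> d)"
    by (simp add: r_def)
  have "ip r q = 0"
  \<comment> \<open>In degree 0 the degree cannot drop; there the difference vanishes
    instead.\<close>
  proof (cases "d = 0")
    case True
    obtain a where a: "p = [:a:]"
      using True degree_eq_zeroE[of p] by (auto simp: d_def)
    obtain b where b: "\<Phi> 0 = [:b:]"
      using \<Phi>(1)[of 0] degree_eq_zeroE by metis
    have "r = 0"
      using \<Phi>(2)[of 0] True by (simp add: r_def a b)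
    then show ?thesis by simp
  next
    case False
    have le: "degree r \<le> d"
      using \<Phi>(1)[of d] degree_smult_le[of "lead_coeff p" "\<Phi> d"]
      by (auto simp: r_def d_def intro: degree_diff_le)
    moreover have "coeff r d = 0"
      by (simp add: r_def d_def \<Phi>(2))
    ultimately have "degree r < d"
      using False by (metis degree_0 eq_zero_or_degree_less gr0I)
    then show ?thesis
      using less by (intro less(1)) (auto simp: d_def)
  qed
  moreover have "ip (\<Phi> d) q = 0"
    using less by (intro orth) (auto simp: d_def)
  ultimately show ?case
    by (subst p) (simp add: ip_add_left ip_smult_left)
qed

end

section \<open>The entropy bound\<close>

lemma dtheta_eq_density: "dtheta = density lborel (\<lambda>t. ennreal (indicator {0..2 * pi} t / (2 * pi)))"
  unfolding dtheta_def uniform_measure_def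
  by (intro arg_cong2[where f = density] refl ext) (auto simp: indicator_def ennreal_1 divide_ennreal[of 1 "2 * pi", simplified])

lemma prob_space_dtheta: "prob_space dtheta"
  unfolding dtheta_def by (rule prob_space_uniform_measure) auto

lemma sets_dtheta [simp, measurable_cong]: "sets dtheta = sets borel"
  by (simp add: dtheta_def)

lemma space_dtheta [simp]: "space dtheta = UNIV"
  by (simp add: dtheta_def uniform_measure_def)

lemma measurable_cis [measurable]: "cis \<in> borel_measurable borel"
  by (intro borel_measurable_continuous_onI continuous_intros)

lemma has_integral_imp_dtheta:
  fixes f :: "real \<Rightarrow> 'a::euclidean_space"
  assumes "continuous_on UNIV f" "(f has_integral (2 * pi) *\<^sub>R I) {0..2 * pi}"
  shows "(LINT t|dtheta. f t) = I"
proof -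
  have [measurable]: "f \<in> borel_measurable borel"
    using assms(1) by (rule borel_measurable_continuous_onI)
  have "set_integrable lborel {0..2 * pi} f"
    by (intro borel_integrable_atLeastAtMost') (use assms(1) continuous_on_subset in blast)
  then have "(LINT t:{0..2 * pi}|lborel. f t) = integral {0..2 * pi} f"
    by (rule set_borel_integral_eq_integral)
  also have "\<dots> = (2 * pi) *\<^sub>R I"
    using assms(2) by (rule integral_unique)
  finally have *: "(LINT t|lborel. indicator {0..2 * pi} t *\<^sub>R f t) = (2 * pi) *\<^sub>R I"
    by (simp add: set_lebesgue_integral_def)
  have "(LINT t|dtheta. f t) = (LINT t|lborel. (indicator {0..2 * pi} t / (2 * pi)) *\<^sub>R f t)"
    unfolding dtheta_eq_density by (rule integral_density) auto
  also have "\<dots> = (LINT t|lborel. (1 / (2 * pi)) *\<^sub>R (indicator {0..2 * pi} t *\<^sub>R f t))"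
    by (intro Bochner_Integration.integral_cong) auto
  also have "\<dots> = (1 / (2 * pi)) *\<^sub>R ((2 * pi) *\<^sub>R I)"
    unfolding integral_scaleR_right * ..
  finally show ?thesis by simp
qed

lemma integrable_dtheta_continuous:
  fixes f :: "real \<Rightarrow> 'a::{banach, second_countable_topology}"
  assumes "continuous_on UNIV f"
  shows "integrable dtheta f"
proof -
  have [measurable]: "f \<in> borel_measurable borel"
    using assms by (rule borel_measurable_continuous_onI)
  have "set_integrable lborel {0..2 * pi} f"
    by (intro borel_integrable_atLeastAtMost') (use assms continuous_on_subset in blast)
  then have "integrable lborel (\<lambda>t. (1 / (2 * pi)) *\<^sub>R (indicator {0..2 * pi} t *\<^sub>R f t))"
    unfolding set_integrable_def by (rule integrable_scaleR_right)
  then show ?thesis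
    unfolding dtheta_eq_density by (subst integrable_density) auto
qed

lemma verblunsky_circle_measure:
  assumes "verblunsky \<mu> \<alpha>"
  shows "circle_measure \<mu>" "prob_space \<mu>"
proof -
  have *: "prob_space \<mu>" "sets \<mu> = sets borel" "emeasure \<mu> (- sphere 0 1) = 0"
    using assms by (auto simp: verblunsky_def nontrivial_circle_prob_def)
  then interpret prob_space \<mu> by simp
  show "circle_measure \<mu>"
    using * by unfold_locales auto
  show "prob_space \<mu>" by fact
qed

text \<open>A monic polynomial of degree 0 is 1, so the recursion identifies the orthogonal
  polynomials of \<open>\<mu>\<close> with \<open>szego \<alpha>\<close>.\<close>

lemma verblunsky_orthogonal:
  assumes "verblunsky \<mu> \<alpha>" "m \<noteq> n"
  shows "circle_measure.ip \<mu> (szego \<alpha> m) (szego \<alpha> n) = 0"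
proof -
  interpret circle_measure \<mu>
    using assms(1) by (rule verblunsky_circle_measure)
  obtain \<Phi> where \<Phi>: "monic_orthogonal_polys \<mu> \<Phi>"
    "\<And>n. \<Phi> (Suc n) = pCons 0 (\<Phi> n) - smult (cnj (\<alpha> n)) (star_poly (\<Phi> n))"
    using assms(1) by (auto simp: verblunsky_def)
  have "\<Phi> 0 = 1"
    using \<Phi>(1) by (auto simp: monic_orthogonal_polys_def elim!: degree_eq_zeroE[of "\<Phi> 0"])
      (metis degree_eq_zeroE lead_coeff_pCons(2) one_pCons)
  then have "\<Phi> n = szego \<alpha> n" for n
    by (induction n) (simp_all add: \<Phi>(2))
  then show ?thesis
    using \<Phi>(1) assms(2) by (simp add: monic_orthogonal_polys_def ip_def)
qed

lemma verblunsky_norm: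
  assumes "verblunsky \<mu> \<alpha>"
  shows "(LINT z|\<mu>. (norm (poly (szego \<alpha> n) z))\<^sup>2) = (\<Prod>k<n. 1 - (norm (\<alpha> k))\<^sup>2)"
proof -
  interpret circle_measure \<mu>
    using assms by (rule verblunsky_circle_measure)
  have "ip (szego \<alpha> n) (szego \<alpha> n) = of_real (\<Prod>k<n. 1 - (norm (\<alpha> k))\<^sup>2) * ip 1 1"
  proof (rule ip_szego_norm)
    fix m and p :: "complex poly" assume "m < n" "degree p \<le> m"
    show "ip p (szego \<alpha> (Suc m)) = 0"
    proof (rule ip_lower_degree[of "szego \<alpha>" "Suc m"])
      fix i assume "i < Suc m"
      then show "ip (szego \<alpha> i) (szego \<alpha> (Suc m)) = 0"
        by (intro verblunsky_orthogonal[OF assms]) auto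
    qed (use \<open>degree p \<le> m\<close> in auto)
  qed
  moreover have "ip 1 1 = 1"
    using prob_space.prob_space[OF verblunsky_circle_measure(2)[OF assms]] by (simp add: ip_def)
  moreover have "ip (szego \<alpha> n) (szego \<alpha> n) = of_real (LINT z|\<mu>. (norm (poly (szego \<alpha> n) z))\<^sup>2)"
  proof -
    have *: "cnj x * x = complex_of_real ((norm x)\<^sup>2)" for x
      by (metis complex_norm_square mult.commute)
    show ?thesis
      unfolding ip_def * by (rule integral_complex_of_real)
  qed
  ultimately have "complex_of_real (LINT z|\<mu>. (norm (poly (szego \<alpha> n) z))\<^sup>2) = of_real (\<Prod>k<n. 1 - (norm (\<alpha> k))\<^sup>2)"
    by (simp only: mult_1_right)
  then show ?thesis
    by (simp only: of_real_eq_iff)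
qed

text \<open>Dropping the singular part can only decrease the integral of a nonnegative
  function.\<close>

lemma nn_integral_ac_le:
  assumes "lebesgue_decomposition \<mu> w \<mu>s" "sets \<mu> = sets borel" "f \<in> borel_measurable borel"
  shows "(\<integral>\<^sup>+t. ennreal (w t) * f (cis t) \<partial>dtheta) \<le> (\<integral>\<^sup>+z. f z \<partial>\<mu>)"
proof -
  have [measurable]: "w \<in> borel_measurable borel" "f \<in> borel_measurable borel"
    using assms by (auto simp: lebesgue_decomposition_def)
  have "(\<integral>\<^sup>+t. ennreal (w t) * f (cis t) \<partial>dtheta) = (\<integral>\<^sup>+z. f z \<partial>ac_circle_measure w)"
    unfolding ac_circle_measure_def by (subst nn_integral_distr) (auto simp: nn_integral_density)
  also have "\<dots> \<le> (\<integral>\<^sup>+z. f z \<partial>\<mu>)"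
  proof (rule nn_integral_mono_measure)
    show "sets (ac_circle_measure w) = sets \<mu>"
      by (simp add: ac_circle_measure_def assms)
    then show "ac_circle_measure w \<le> \<mu>"
      using assms(1,2) unfolding lebesgue_decomposition_def
      by (intro le_measure[THEN iffD2]) (auto simp: le_fun_def)
  qed
  finally show ?thesis .
qed

lemma continuous_on_entropy_weight [continuous_intros]: "continuous_on A entropy_weight"
  unfolding entropy_weight_def by (intro continuous_intros)

lemma measurable_entropy_weight [measurable]: "entropy_weight \<in> borel_measurable borel"
  by (intro borel_measurable_continuous_onI continuous_intros)

lemma entropy_weight_bounds: "0 \<le> entropy_weight t" "entropy_weight t \<le> 64"
proof -
  have "0 \<le> 1 - cos t" "1 - cos t \<le> 2" "0 \<le> 1 - sin t" "1 - sin t \<le> 2"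
    using cos_ge_minus_one[of t] cos_le_one[of t] sin_ge_minus_one[of t] sin_le_one[of t] by linarith+
  then have "0 \<le> (1 - cos t) ^ 3" "(1 - cos t) ^ 3 \<le> 2 ^ 3" "0 \<le> (1 - sin t) ^ 3" "(1 - sin t) ^ 3 \<le> 2 ^ 3"
    using power_mono[of "1 - cos t" 2 3] power_mono[of "1 - sin t" 2 3] by auto
  then show "0 \<le> entropy_weight t" "entropy_weight t \<le> 64"
    using mult_mono[of "(1 - cos t) ^ 3" "2 ^ 3" "(1 - sin t) ^ 3" "2 ^ 3"]
    by (auto simp: entropy_weight_def)
qed

text \<open>The 64 is the bound of the weight; the integral of w |phi_n|^2 is at most 1. Only the
  positive part of the integrand is estimated, which suffices for an upper bound and stays within
  nonnegative integrals.\<close>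

lemma entropy_le_bound:
  assumes V: "verblunsky \<mu> \<alpha>" and L: "lebesgue_decomposition \<mu> w \<mu>s"
    and \<alpha>: "\<And>k. norm (\<alpha> k) < 1"
    and fin: "(\<integral>\<^sup>+t. e2ennreal (- (ereal (entropy_weight t) * ext_ln (w t))) \<partial>dtheta) = ennreal N" "N \<ge> 0"
  shows "(LINT t|dtheta. entropy_weight t *
           ln ((norm (poly (szego \<alpha> n) (cis t)))\<^sup>2 / (\<Prod>k<n. 1 - (norm (\<alpha> k))\<^sup>2))) \<le> 64 + N"
proof (rule integral_real_bounded)
  define P where "P = (\<Prod>k<n. 1 - (norm (\<alpha> k))\<^sup>2)"
  define \<phi> where "\<phi> = (\<lambda>z. (norm (poly (szego \<alpha> n) z))\<^sup>2 / P)"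
  interpret circle_measure \<mu>
    using V by (rule verblunsky_circle_measure)
  have wm [measurable]: "w \<in> borel_measurable borel" and w0: "\<And>t. w t \<ge> 0"
    using L by (auto simp: lebesgue_decomposition_def)
  have P: "P > 0"
    unfolding P_def using \<alpha> by (intro prod_pos) (auto simp: abs_square_less_1)
  have \<phi>m [measurable]: "\<phi> \<in> borel_measurable borel"
    unfolding \<phi>_def using P by (intro borel_measurable_continuous_onI continuous_intros) auto
  have em [measurable]: "(\<lambda>t. ext_ln (w t)) \<in> borel_measurable borel"
    unfolding ext_ln_def by measurable
  have \<phi>pos: "\<phi> (cis t) > 0" for t
    using szego_disc(2)[of \<alpha> "cis t" n] \<alpha> norm_szego_circle[of "cis t" \<alpha> n] P
    unfolding \<phi>_def by (intro divide_pos_pos zero_less_power) (auto simp: norm_cis)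
  have pointwise: "ennreal (entropy_weight t * ln (\<phi> (cis t))) \<le>
      64 * (ennreal (w t) * ennreal (\<phi> (cis t))) + e2ennreal (- (ereal (entropy_weight t) * ext_ln (w t)))" for t
  proof (cases "entropy_weight t = 0")
    case True
    then show ?thesis by simp
  next
    case False
    then have h: "entropy_weight t > 0"
      using entropy_weight_bounds(1)[of t] by linarith
    show ?thesis
    proof (cases "w t = 0")
      case True
      \<comment> \<open>At zeros of \<open>w\<close> the right-hand side is infinite.\<close>
      then have "- (ereal (entropy_weight t) * ext_ln (w t)) = \<infinity>"
        using h by (simp add: ext_ln_def)
      then show ?thesis by simp
    next
      case False
      then have w: "w t > 0" using w0[of t] by linarith
      have "ln (w t * \<phi> (cis t)) \<le> w t * \<phi> (cis t)"
        using w \<phi>pos[of t] ln_le_minus_one[of "w t * \<phi> (cis t)"] by simp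
      then have "ln (\<phi> (cis t)) \<le> w t * \<phi> (cis t) - ln (w t)"
        using w \<phi>pos[of t] by (simp add: ln_mult)
      then have "entropy_weight t * ln (\<phi> (cis t)) \<le> entropy_weight t * (w t * \<phi> (cis t) - ln (w t))"
        using h by (intro mult_left_mono) auto
      also have "\<dots> \<le> 64 * (w t * \<phi> (cis t)) + - (entropy_weight t * ln (w t))"
        using mult_right_mono[OF entropy_weight_bounds(2)[of t], of "w t * \<phi> (cis t)"] w \<phi>pos[of t]
        by (simp add: right_diff_distrib less_imp_le)
      finally have "ennreal (entropy_weight t * ln (\<phi> (cis t)))
          \<le> ennreal (64 * (w t * \<phi> (cis t)) + - (entropy_weight t * ln (w t)))"
        by (rule ennreal_leI)
      also have "\<dots> \<le> ennreal (64 * (w t * \<phi> (cis t))) + ennreal (- (entropy_weight t * ln (w t)))"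
        by (cases "0 \<le> - (entropy_weight t * ln (w t))")
           (use w \<phi>pos[of t] in \<open>auto simp: ennreal_plus ennreal_neg intro!: ennreal_leI simp flip: ennreal_plus\<close>)
      finally show ?thesis
        using w \<phi>pos[of t] False
        by (simp add: ext_ln_def ennreal_mult less_imp_le e2ennreal_ereal)
    qed
  qed
  have "(\<integral>\<^sup>+t. ennreal (w t) * ennreal (\<phi> (cis t)) \<partial>dtheta) \<le> (\<integral>\<^sup>+z. ennreal (\<phi> z) \<partial>\<mu>)"
    by (intro nn_integral_ac_le[OF L sets_M]) auto
  also have "(\<integral>\<^sup>+z. ennreal (\<phi> z) \<partial>\<mu>) = ennreal (LINT z|\<mu>. \<phi> z)"
  proof (rule nn_integral_eq_integral)
    have "integrable \<mu> (\<lambda>z. Re (of_real ((norm (poly (szego \<alpha> n) z))\<^sup>2 / P)))"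
      using P by (intro integrable_Re integrable_continuous continuous_intros) auto
    then show "integrable \<mu> \<phi>" by (simp add: \<phi>_def)
  qed (use P in \<open>auto simp: \<phi>_def\<close>)
  also have "(LINT z|\<mu>. \<phi> z) = 1"
    using P verblunsky_norm[OF V, of n] by (simp add: \<phi>_def P_def [symmetric])
  finally have I: "(\<integral>\<^sup>+t. ennreal (w t) * ennreal (\<phi> (cis t)) \<partial>dtheta) \<le> 1"
    by simp
  have "(\<integral>\<^sup>+t. ennreal (entropy_weight t * ln (\<phi> (cis t))) \<partial>dtheta) \<le>
     (\<integral>\<^sup>+t. 64 * (ennreal (w t) * ennreal (\<phi> (cis t))) + e2ennreal (- (ereal (entropy_weight t) * ext_ln (w t))) \<partial>dtheta)"
    by (intro nn_integral_mono pointwise)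
  also have "\<dots> = 64 * (\<integral>\<^sup>+t. ennreal (w t) * ennreal (\<phi> (cis t)) \<partial>dtheta) + ennreal N"
    unfolding fin(1) [symmetric] by (subst nn_integral_add) (auto simp: nn_integral_cmult)
  also have "\<dots> \<le> 64 * 1 + ennreal N"
    by (intro add_mono mult_left_mono I) auto
  finally show "(\<integral>\<^sup>+t. ennreal (entropy_weight t * ln ((norm (poly (szego \<alpha> n) (cis t)))\<^sup>2 / (\<Prod>k<n. 1 - (norm (\<alpha> k))\<^sup>2))) \<partial>dtheta)
      \<le> ennreal (64 + N)"
    using fin(2) by (simp add: \<phi>_def P_def [symmetric] ennreal_plus)
qed (use fin in auto)

section \<open>Divergence of the entropy\<close>

lemma integral_entropy_weight: "(LINT t|dtheta. entropy_weight t) = 41 / 8"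
proof (rule has_integral_imp_dtheta)
  have "((\<lambda>t. poly weight_poly (cis t) * cis (- (real 6 * t))) has_integral
      2 * pi * fps_nth (fps_of_poly weight_poly) 6) {0..2 * pi}"
    by (rule circle_fourier_coefficient[of _ 2]) (auto intro!: holomorphic_intros poly_has_fps_expansion)
  moreover have "coeff weight_poly 6 = 41 / 8"
    by (simp add: weight_poly_eq eval_nat_numeral)
  ultimately have "((\<lambda>t. complex_of_real (entropy_weight t)) has_integral complex_of_real (2 * pi) * (41 / 8)) {0..2 * pi}"
    by (simp only: weight_poly_cis fps_of_poly_nth)
  from has_integral_Re[OF this] show "(entropy_weight has_integral (2 * pi) *\<^sub>R (41 / 8)) {0..2 * pi}"
    by simp
qed (intro continuous_intros)

text \<open>On the circle Phi_n and its reversal have equal modulus, and the reversal is the one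
  without zeros in the disc.\<close>

lemma integral_entropy_log_szego:
  fixes n :: nat
  assumes \<alpha>: "\<And>k. norm (\<alpha> k) < 1"
  defines "P \<equiv> (\<Prod>k<n. 1 - (norm (\<alpha> k))\<^sup>2)"
  shows "(LINT t|dtheta. entropy_weight t * ln ((norm (poly (szego \<alpha> n) (cis t)))\<^sup>2 / P)) =
    2 * Re (fps_nth (fps_of_poly weight_poly * fps_log (fps_of_poly (star_poly (szego \<alpha> n)))) 6) - 41 / 8 * ln P"
proof -
  have P: "P > 0"
    unfolding P_def using \<alpha> by (intro prod_pos) (auto simp: abs_square_less_1)
  define p where "p = star_poly (szego \<alpha> n)"
  have nz: "poly p z \<noteq> 0" if "norm z \<le> 1" for z
    unfolding p_def using szego_disc(2)[OF \<alpha> that] .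
  have cont: "continuous_on UNIV (\<lambda>t. entropy_weight t * ln (norm (poly p (cis t))))"
    using nz by (intro continuous_intros) auto
  have I: "(LINT t|dtheta. entropy_weight t * ln (norm (poly p (cis t)))) =
      Re (fps_nth (fps_of_poly weight_poly * fps_log (fps_of_poly p)) 6)"
    using has_integral_weight_log_poly[OF nz] cont by (intro has_integral_imp_dtheta) (auto simp: p_def)
  have "entropy_weight t * ln ((norm (poly (szego \<alpha> n) (cis t)))\<^sup>2 / P) =
      2 * (entropy_weight t * ln (norm (poly p (cis t)))) - entropy_weight t * ln P" for t
  proof -
    have eq: "norm (poly (szego \<alpha> n) (cis t)) = norm (poly p (cis t))"
      unfolding p_def by (simp add: norm_szego_circle)
    have "norm (poly p (cis t)) > 0"
      using nz[of "cis t"] by simp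
    then have ln_eq: "ln ((norm (poly p (cis t)))\<^sup>2 / P) = 2 * ln (norm (poly p (cis t))) - ln P"
      using P by (simp add: ln_div ln_realpow)
    show ?thesis
      unfolding eq ln_eq by (simp add: algebra_simps)
  qed
  then have "(LINT t|dtheta. entropy_weight t * ln ((norm (poly (szego \<alpha> n) (cis t)))\<^sup>2 / P)) =
      (LINT t|dtheta. 2 * (entropy_weight t * ln (norm (poly p (cis t)))) - entropy_weight t * ln P)"
    by simp
  also have "\<dots> = 2 * (LINT t|dtheta. entropy_weight t * ln (norm (poly p (cis t)))) - (LINT t|dtheta. entropy_weight t) * ln P"
    using integrable_dtheta_continuous[OF cont] integrable_dtheta_continuous[OF continuous_on_entropy_weight]
    by simp
  finally show ?thesis
    unfolding I integral_entropy_weight unfolding p_def .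
qed

text \<open>The difference has derivative y^3 / (1 - y). A one-sided bound is enough here, since the
  entropy increments only have to be bounded from below.\<close>

lemma minus_ln_one_minus_ge:
  fixes x :: real
  assumes "0 \<le> x" "x < 1"
  shows "x + x\<^sup>2 / 2 + x ^ 3 / 3 \<le> - ln (1 - x)"
proof -
  define g where "g = (\<lambda>x::real. - ln (1 - x) - (x + x\<^sup>2 / 2 + x ^ 3 / 3))"
  have "g 0 \<le> g x"
  proof (rule DERIV_nonneg_imp_nondecreasing[OF assms(1)])
    fix y assume y: "0 \<le> y" "y \<le> x"
    have "(g has_real_derivative (1 / (1 - y) - (1 + y + y\<^sup>2))) (at y)"
      unfolding g_def using y assms by (auto intro!: derivative_eq_intros simp: field_simps power2_eq_square)
    moreover have "1 / (1 - y) - (1 + y + y\<^sup>2) = y ^ 3 / (1 - y)"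
      using y assms by (simp add: field_simps power2_eq_square power3_eq_cube)
    ultimately show "\<exists>d. (g has_real_derivative d) (at y) \<and> 0 \<le> d"
      using y assms by auto
  qed
  then show ?thesis by (simp add: g_def)
qed

section \<open>Growth of the entropy over the blocks\<close>

locale szego_resonant = 
  resonant \<alpha> "\<lambda>n. fps_of_poly (szego \<alpha> n)" "\<lambda>n. fps_of_poly (star_poly (szego \<alpha> n))" "\<lambda>k. complex_of_real (r k)"
  for \<alpha> r +
  assumes \<alpha>_less: "\<And>k. norm (\<alpha> k) < 1" and r6: "\<not> summable (\<lambda>k. r k ^ 6)"
begin

definition u :: "nat \<Rightarrow> nat \<Rightarrow> real" where
  "u i k = (norm (\<alpha> (4 * k + i)))\<^sup>2"

lemma u_bounds: "0 \<le> u i k" "u i k < 1"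
  using \<alpha>_less by (auto simp: u_def abs_square_less_1)

text \<open>\<open>J k\<close> is the integral of $H \log |\varphi_{4k}|^2$; the number $41/8$ is the mean of $H$.\<close>

definition J :: "nat \<Rightarrow> real" where
  "J k = 2 * Re (fps_nth (fps_of_poly weight_poly * fps_log (fps_of_poly (star_poly (szego \<alpha> (4 * k))))) 6)
     - 41 / 8 * ln (\<Prod>j<4 * k. 1 - (norm (\<alpha> j))\<^sup>2)"

definition cubic :: "real \<Rightarrow> real" where
  "cubic x = x + x\<^sup>2 / 2 + x ^ 3 / 3"

text \<open>The increment of \<open>J\<close> with the logarithms of the normalization cut off at
  third order; complex-valued for use with \<open>jet\<close>.\<close>

definition gain :: "nat \<Rightarrow> complex" where
  "gain k = 2 * fps_nth (fps_of_poly weight_poly * fps_integral0 (logder k)) 6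
     + 41 / 8 * of_real (cubic (u 0 k) + cubic (u 1 k) + cubic (u 2 k) + cubic (u 3 k))"

text \<open>By \<open>fps_log_mult\<close> the increment of the Taylor part is the logarithm of
  \<open>ratio k\<close> alone; the cut-off terms of -ln (1 - u) are nonnegative.\<close>

lemma J_Suc: "J (Suc k) - J k \<ge> Re (gain k)"
proof -
  have "fps_log (fps_of_poly (star_poly (szego \<alpha> (4 * Suc k)))) =
      fps_log (ratio k * fps_of_poly (star_poly (szego \<alpha> (4 * k))))"
    by (simp add: ratio_def mult.assoc inverse_mult_eq_1 del: mult_Suc_right szego.simps)
  also have "\<dots> = fps_integral0 (logder k) + fps_log (fps_of_poly (star_poly (szego \<alpha> (4 * k))))"
    by (subst fps_log_mult) (auto simp: fps_log_def logder_def)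
  finally have log: "fps_log (fps_of_poly (star_poly (szego \<alpha> (4 * Suc k)))) =
      fps_integral0 (logder k) + fps_log (fps_of_poly (star_poly (szego \<alpha> (4 * k))))" .
  define Q where "Q = (\<Prod>j<4 * k. 1 - (norm (\<alpha> j))\<^sup>2)"
  have Q: "Q > 0"
    unfolding Q_def using \<alpha>_less by (intro prod_pos) (auto simp: abs_square_less_1)
  have "(\<Prod>j<4 * Suc k. 1 - (norm (\<alpha> j))\<^sup>2) = Q * (1 - u 0 k) * (1 - u 1 k) * (1 - u 2 k) * (1 - u 3 k)"
  proof -
    have "4 * Suc k = Suc (Suc (Suc (Suc (4 * k))))" by simp
    then show ?thesis
      by (simp only: prod.lessThan_Suc Q_def u_def) (simp add: numeral_3_eq_3 numeral_2_eq_2)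
  qed
  moreover have "u i k \<noteq> 1" for i
    using u_bounds(2)[of i k] by simp
  ultimately have ln: "ln (\<Prod>j<4 * Suc k. 1 - (norm (\<alpha> j))\<^sup>2) =
      ln Q + ln (1 - u 0 k) + ln (1 - u 1 k) + ln (1 - u 2 k) + ln (1 - u 3 k)"
    using Q by (simp only:) (simp add: ln_mult)
  have "J (Suc k) - J k = Re (2 * fps_nth (fps_of_poly weight_poly * fps_integral0 (logder k)) 6)
      + 41 / 8 * (- ln (1 - u 0 k) + - ln (1 - u 1 k) + - ln (1 - u 2 k) + - ln (1 - u 3 k))"
    unfolding J_def log ln Q_def [symmetric] by (simp add: ring_distribs)
  also have "\<dots> \<ge> Re (gain k)"
    unfolding gain_def cubic_def
    using minus_ln_one_minus_ge[OF u_bounds, of 0 k] minus_ln_one_minus_ge[OF u_bounds, of 1 k]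
      minus_ln_one_minus_ge[OF u_bounds, of 2 k] minus_ln_one_minus_ge[OF u_bounds, of 3 k]
    by simp
  finally show ?thesis .
qed

lemma u_eq: "complex_of_real (u i k) = va k i * vc k i"
  unfolding u_def by (rule complex_norm_square)

lemma jet_cubic_u:
  assumes "jet (\<lambda>k. va k i * vc k i) 0 c 0 0"
  shows "jet (\<lambda>k. of_real (cubic (u i k))) 0 c (c\<^sup>2 / 2) (c ^ 3 / 3)"
proof -
  have 2: "jet (\<lambda>k. va k i * vc k i * (va k i * vc k i)) 0 0 (c\<^sup>2) 0"
    by (rule jet_coeffs[OF jet_mult[OF assms assms]]) (simp_all add: power2_eq_square)
  have 3: "jet (\<lambda>k. va k i * vc k i * (va k i * vc k i) * (va k i * vc k i)) 0 0 0 (c ^ 3)"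
    by (rule jet_coeffs[OF jet_mult[OF 2 assms]]) (simp_all add: power2_eq_square power3_eq_cube)
  show ?thesis
    by (rule jet_eq[OF jet_add[OF assms jet_add[OF jet_cmult[OF 2, of "1/2"] jet_cmult[OF 3, of "1/3"]]]])
       (simp_all add: cubic_def u_eq power2_eq_square power3_eq_cube)
qed

text \<open>Modulo summable errors the \<open>u i k\<close> are b, b/2, 0, b/2, so the cubic
  truncations add up to 2 b + (3/4) b^2 + (5/12) b^3. Against \<open>jet_log_ratio\<close> this
  leaves 205/96 - 181/96 = 1/4.\<close>

lemma jet_gain: "jet gain 0 0 0 (1/4)"
proof -
  note c = jet_cubic_u[OF jet_va_vc_values(1)] jet_cubic_u[OF jet_va_vc_values(2)]
    jet_cubic_u[OF jet_va_vc_values(3)] jet_cubic_u[OF jet_va_vc_values(4)]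
  have "jet (\<lambda>k. of_real (cubic (u 0 k)) + of_real (cubic (u 1 k)) + of_real (cubic (u 2 k)) + of_real (cubic (u 3 k)))
      0 2 (3/4) (5/12)"
    by (rule jet_coeffs[OF jet_add[OF jet_add[OF jet_add[OF c(1) c(2)] c(3)] c(4)]])
       (simp_all add: power2_eq_square power3_eq_cube)
  from jet_add[OF jet_log_ratio jet_cmult[OF this, of "41/8"]] show ?thesis
    by (rule jet_eq) (simp_all add: gain_def)
qed

lemma J_unbounded: "\<exists>k. J k > C"
proof (rule ccontr)
  assume "\<not> (\<exists>k. J k > C)"
  then have C: "J k \<le> C" for k
    by (meson not_le)
  define e where "e = (\<lambda>k. gain k - 1/4 * (4 * complex_of_real (r k) ^ 2) ^ 3)"
  have e: "summable (\<lambda>k. norm (e k))"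
    using jet_gain by (simp add: jet_def l1_def e_def)
  have ge: "J (Suc k) - J k \<ge> 16 * r k ^ 6 - norm (e k)" for k
  proof -
    \<comment> \<open>With b = 4 r^2, the term b^3 / 4 is 16 r^6.\<close>
    have "gain k = of_real (16 * r k ^ 6) + e k"
      by (simp add: e_def power_mult_distrib flip: power_mult)
    then have "Re (gain k) \<ge> 16 * r k ^ 6 - norm (e k)"
      using abs_Re_le_cmod[of "e k"] by simp
    then show ?thesis using J_Suc[of k] by linarith
  qed
  have sum: "(\<Sum>k<N. 16 * r k ^ 6) \<le> C - J 0 + (\<Sum>k. norm (e k))" for N
  proof -
    have "(\<Sum>k<N. 16 * r k ^ 6) \<le> (\<Sum>k<N. (J (Suc k) - J k) + norm (e k))"
      using ge by (intro sum_mono) (simp add: algebra_simps)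
    also have "\<dots> = J N - J 0 + (\<Sum>k<N. norm (e k))"
      by (simp add: sum.distrib sum_lessThan_telescope)
    also have "\<dots> \<le> C - J 0 + (\<Sum>k. norm (e k))"
      using C[of N] sum_le_suminf[OF e, of "{..<N}"] by simp
    finally show ?thesis .
  qed
  have "summable (\<lambda>k. 16 * r k ^ 6)"
    by (rule bounded_imp_summable[OF _ sum[of "Suc _", unfolded lessThan_Suc_atMost]]) simp
  then have "summable (\<lambda>k. 1/16 * (16 * r k ^ 6))"
    by (rule summable_mult)
  then show False using r6 by simp
qed

lemma entropy_integral_eq_minus_infinity:
  assumes V: "verblunsky \<mu> \<alpha>" and L: "lebesgue_decomposition \<mu> w \<mu>s"
  shows "entropy_integral entropy_weight w = - \<infinity>"
proof -
  define f where "f = (\<lambda>t. ereal (entropy_weight t) * ext_ln (w t))"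
  have w0: "\<And>t. w t \<ge> 0" and wm [measurable]: "w \<in> borel_measurable borel"
    using L by (auto simp: lebesgue_decomposition_def)
  have neg: "(\<integral>\<^sup>+t. e2ennreal (- f t) \<partial>dtheta) = \<infinity>"
  proof (rule ccontr)
    assume "(\<integral>\<^sup>+t. e2ennreal (- f t) \<partial>dtheta) \<noteq> \<infinity>"
    then obtain N where N: "(\<integral>\<^sup>+t. e2ennreal (- f t) \<partial>dtheta) = ennreal N" "N \<ge> 0"
      by (cases "\<integral>\<^sup>+t. e2ennreal (- f t) \<partial>dtheta") auto
    have "J k \<le> 64 + N" for k
      using entropy_le_bound[OF V L \<alpha>_less N(1)[unfolded f_def] N(2), of "4 * k"]
      unfolding integral_entropy_log_szego[of \<alpha>, OF \<alpha>_less] J_def .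
    then show False using J_unbounded[of "64 + N"] by (meson not_le)
  qed
  \<comment> \<open>The positive part has to be finite: the integral is a difference of two parts,
    and infinity minus infinity would not give minus infinity.\<close>
  have "(\<integral>\<^sup>+t. e2ennreal (f t) \<partial>dtheta) \<le> (\<integral>\<^sup>+t. 64 * (ennreal (w t) * 1) \<partial>dtheta)"
  proof (intro nn_integral_mono)
    fix t
    show "e2ennreal (f t) \<le> 64 * (ennreal (w t) * 1)"
    proof (cases "w t = 0")
      case True
      then have "f t \<le> 0"
        using entropy_weight_bounds(1)[of t] by (cases "entropy_weight t = 0") (auto simp: f_def ext_ln_def)
      then show ?thesis by (simp add: e2ennreal_neg)
    next
      case False
      then have w: "w t > 0" using w0[of t] by linarith
      have "entropy_weight t * ln (w t) \<le> entropy_weight t * w t"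
        using entropy_weight_bounds(1)[of t] ln_le_minus_one[OF w] by (intro mult_left_mono) auto
      also have "\<dots> \<le> 64 * w t"
        using entropy_weight_bounds(2)[of t] w by (intro mult_right_mono) auto
      finally have "ennreal (entropy_weight t * ln (w t)) \<le> ennreal (64 * w t)"
        by (rule ennreal_leI)
      then show ?thesis
        using False w by (simp add: f_def ext_ln_def ennreal_mult)
    qed
  qed
  also have "\<dots> = 64 * (\<integral>\<^sup>+t. ennreal (w t) * 1 \<partial>dtheta)"
    by (rule nn_integral_cmult) simp
  also have "\<dots> \<le> 64 * (\<integral>\<^sup>+z. 1 \<partial>\<mu>)"
    using circle_measure.sets_M[OF verblunsky_circle_measure(1)[OF V]]
    by (intro mult_left_mono nn_integral_ac_le[OF L, of "\<lambda>_. 1"]) auto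
  also have "\<dots> = 64"
    using prob_space.emeasure_space_1[OF verblunsky_circle_measure(2)[OF V]] by simp
  finally have "(\<integral>\<^sup>+t. e2ennreal (f t) \<partial>dtheta) \<le> 64" .
  then obtain p where "(\<integral>\<^sup>+t. e2ennreal (f t) \<partial>dtheta) = ennreal p" "p \<ge> 0"
    by (cases "\<integral>\<^sup>+t. e2ennreal (f t) \<partial>dtheta") (auto simp: top_unique)
  then show ?thesis
    using neg by (simp add: entropy_integral_def ext_integral_def f_def)
qed

end

section \<open>Verblunsky's theorem\<close>

text \<open>The Bernstein--Szego measures $d\theta / 2\pi|\varphi_n|^2$ have the first \<open>n\<close>
  Verblunsky coefficients prescribed; a weak limit of them has all of them.\<close>

locale verblunsky_seq =
  fixes \<alpha> :: "nat \<Rightarrow> complex"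
  assumes \<alpha>_less: "\<And>k. norm (\<alpha> k) < 1"
begin

definition rho2 :: "nat \<Rightarrow> real" where
  "rho2 n = (\<Prod>k<n. 1 - (norm (\<alpha> k))\<^sup>2)"

lemma rho2_pos: "rho2 n > 0"
  unfolding rho2_def using \<alpha>_less by (intro prod_pos) (auto simp: abs_square_less_1)

definition bs_density :: "nat \<Rightarrow> real \<Rightarrow> real" where
  "bs_density n t = rho2 n / (norm (poly (szego \<alpha> n) (cis t)))\<^sup>2"

text \<open>Kept on the parameter line, where tightness provides weakly convergent subsequences;
  \<open>cis\<close> carries the measures and their limit to the circle.\<close>

definition bs_measure :: "nat \<Rightarrow> real measure" where
  "bs_measure n = density dtheta (\<lambda>t. ennreal (bs_density n t))"

lemma szego_nonzero: "norm z = 1 \<Longrightarrow> poly (szego \<alpha> n) z \<noteq> 0"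
  using szego_disc(2)[of \<alpha> z n, OF \<alpha>_less] norm_szego_circle[of z \<alpha> n] by auto

lemma continuous_bs_density: "continuous_on UNIV (bs_density n)"
  unfolding bs_density_def using szego_nonzero by (intro continuous_intros) auto

lemma bs_density_nonneg: "bs_density n t \<ge> 0"
  unfolding bs_density_def using rho2_pos[of n] by simp

lemma measurable_bs_density [measurable]: "bs_density n \<in> borel_measurable borel"
  by (rule borel_measurable_continuous_onI[OF continuous_bs_density])

lemma sets_bs_measure [simp, measurable_cong]: "sets (bs_measure n) = sets borel"
  by (simp add: bs_measure_def)

lemma space_bs_measure [simp]: "space (bs_measure n) = UNIV"
  by (simp add: bs_measure_def)

abbreviation bs_circle :: "nat \<Rightarrow> complex measure" where
  "bs_circle n \<equiv> distr (bs_measure n) borel cis"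

lemma finite_bs_measure: "emeasure (bs_measure n) UNIV < \<infinity>"
proof -
  have "emeasure (bs_measure n) UNIV = (\<integral>\<^sup>+t. ennreal (bs_density n t) \<partial>dtheta)"
    unfolding bs_measure_def by (subst emeasure_density) auto
  also have "\<dots> = ennreal (LINT t|dtheta. bs_density n t)"
    by (intro nn_integral_eq_integral integrable_dtheta_continuous continuous_bs_density)
       (auto simp: bs_density_nonneg)
  finally show ?thesis by simp
qed

lemma circle_measure_bs: "circle_measure (bs_circle n)"
proof (intro circle_measure.intro circle_measure_axioms.intro finite_measureI)
  show "emeasure (bs_circle n) (space (bs_circle n)) \<noteq> \<infinity>"
    using finite_bs_measure[of n] by (simp add: emeasure_distr)
  show "emeasure (bs_circle n) (- sphere 0 1) = 0"
  proof (subst emeasure_distr)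
    have "cis -` (- sphere 0 1) = {}" by auto
    then show "emeasure (bs_measure n) (cis -` (- sphere 0 1) \<inter> space (bs_measure n)) = 0"
      by simp
  qed auto
qed simp

lemma integral_bs_circle:
  fixes f :: "complex \<Rightarrow> complex"
  assumes "continuous_on UNIV f"
  shows "(LINT z|bs_circle n. f z) = (LINT t|dtheta. bs_density n t *\<^sub>R f (cis t))"
proof -
  have [measurable]: "f \<in> borel_measurable borel"
    using assms by (rule borel_measurable_continuous_onI)
  have "(LINT z|bs_circle n. f z) = (LINT t|bs_measure n. f (cis t))"
    by (rule integral_distr) auto
  then show ?thesis
    unfolding bs_measure_def by (subst (asm) integral_density) (auto simp: bs_density_nonneg)
qed

lemma bs_ip:
  "circle_measure.ip (bs_circle n) p q = (LINT t|dtheta. bs_density n t *\<^sub>R (cnj (poly p (cis t)) * poly q (cis t)))"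
  unfolding circle_measure.ip_def[OF circle_measure_bs]
  by (intro integral_bs_circle continuous_intros)

lemma bs_ip_szego_self: "circle_measure.ip (bs_circle n) (szego \<alpha> n) (szego \<alpha> n) = rho2 n"
proof -
  have "bs_density n t *\<^sub>R (cnj (poly (szego \<alpha> n) (cis t)) * poly (szego \<alpha> n) (cis t)) = rho2 n" for t
    using szego_nonzero[of "cis t" n] complex_norm_square[of "poly (szego \<alpha> n) (cis t)"]
    by (simp add: bs_density_def scaleR_conv_of_real mult.commute)
  then show ?thesis
    unfolding bs_ip using prob_space.prob_space[OF prob_space_dtheta] by simp
qed

text \<open>On the circle conj(z^j) Phi_n / |Phi_n|^2 equals z^(n-j) / Phi_n^*, which is holomorphic
  beyond the circle. Its mean is its value at 0, and that is 0 because j < n.\<close>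

lemma bs_ip_monom:
  assumes "j < n"
  shows "circle_measure.ip (bs_circle n) (monom 1 j) (szego \<alpha> n) = 0"
proof -
  define s where "s = star_poly (szego \<alpha> n)"
  define f where "f = (\<lambda>z::complex. rho2 n * z ^ (n - j) / poly s z)"
  obtain r where r: "r > 1" "\<And>z. z \<in> ball 0 r \<Longrightarrow> poly s z \<noteq> 0"
    using poly_zero_free_ball[of s] szego_disc(2)[of \<alpha>, OF \<alpha>_less] unfolding s_def by metis
  have hol: "f holomorphic_on ball 0 r"
    unfolding f_def using r(2) by (intro holomorphic_intros) auto
  have exp: "f has_fps_expansion fps_expansion f 0"
    using r(1) by (intro has_fps_expansion_fps_expansion[of "ball 0 r"] hol) auto
  have "fps_nth (fps_expansion f 0) 0 = 0"
    using fps_nth_fps_expansion[OF exp, of 0] assms by (simp add: f_def)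
  then have int: "((\<lambda>t. f (cis t)) has_integral (2 * pi) *\<^sub>R 0) {0..2 * pi}"
    using circle_fourier_coefficient[OF hol r(1) exp, of 0] by (simp add: cis_zero)
  have "bs_density n t *\<^sub>R (cnj (poly (monom 1 j) (cis t)) * poly (szego \<alpha> n) (cis t)) = f (cis t)" for t
  proof -
    define z p where "z = cis t" and "p = poly (szego \<alpha> n) z"
    have z: "norm z = 1" by (simp add: z_def)
    have zz: "cnj z * z = 1"
      using z by (metis complex_norm_square mult.commute of_real_1 power_one)
    have p: "p \<noteq> 0" "cnj p \<noteq> 0" and pp: "of_real ((norm p)\<^sup>2) = p * cnj p"
      using szego_nonzero[OF z] complex_norm_square[of p] by (auto simp: p_def)
    have "cnj z ^ j * z ^ n = (cnj z * z) ^ j * z ^ (n - j)"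
      using assms by (simp add: power_mult_distrib mult.assoc flip: power_add)
    then have zn: "cnj z ^ j * z ^ n = z ^ (n - j)"
      by (simp add: zz)
    have z0: "z \<noteq> 0" using z by auto
    have "f z = rho2 n * (cnj z ^ j * z ^ n) / (z ^ n * cnj p)"
      unfolding f_def s_def poly_star_szego_circle[OF z] zn p_def ..
    also have "\<dots> = rho2 n * cnj z ^ j / cnj p"
      using z0 by simp
    also have "\<dots> = rho2 n / (p * cnj p) * (cnj z ^ j * p)"
      using p by simp
    finally show ?thesis
      unfolding z_def [symmetric] p_def [symmetric] bs_density_def
      by (simp add: poly_monom scaleR_conv_of_real pp del: of_real_power)
  qed
  then have "circle_measure.ip (bs_circle n) (monom 1 j) (szego \<alpha> n) = (LINT t|dtheta. f (cis t))"
    unfolding bs_ip by simp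
  also have "\<dots> = 0"
  proof (rule has_integral_imp_dtheta[OF _ int])
    show "continuous_on UNIV (\<lambda>t. f (cis t))"
      unfolding f_def using r by (intro continuous_intros) auto
  qed
  finally show ?thesis .
qed

text \<open>Descending induction from \<open>n\<close> through \<open>szego_backward\<close>. Tested
  against z^(j+1), both terms on the right vanish: reversal turns the exponent j + 1 into m - j, and
  both are below m + 1.\<close>

lemma bs_ip_monom_lower:
  assumes "m \<le> n" "j < m"
  shows "circle_measure.ip (bs_circle n) (monom 1 j) (szego \<alpha> m) = 0"
  using assms
proof (induction m arbitrary: j rule: inc_induct)
  case base
  then show ?case by (rule bs_ip_monom)
next
  case (step m)
  interpret circle_measure "bs_circle n" by (rule circle_measure_bs)
  let ?S = "szego \<alpha> (Suc m)"
  have star: "ip (monom 1 (Suc j)) (star_poly ?S) = cnj (ip (monom 1 (m - j)) ?S)"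
  proof -
    have "cnj (poly (monom 1 (Suc j)) z) * poly (star_poly ?S) z = cnj (poly (?S) z) * poly (monom 1 (m - j)) z"
      if z: "norm z = 1" for z
    proof -
      have zz: "cnj z * z = 1"
        using z by (metis complex_norm_square mult.commute of_real_1 power_one)
      have "cnj z ^ Suc j * z ^ Suc m = (cnj z * z) ^ Suc j * z ^ (m - j)"
        using step.prems by (simp add: power_mult_distrib mult.assoc flip: power_add power_Suc)
      then have "cnj z ^ Suc j * z ^ Suc m = z ^ (m - j)"
        by (simp add: zz)
      then show ?thesis
        unfolding poly_star_szego_circle[OF z] by (simp add: poly_monom mult_ac del: szego.simps power_Suc)
    qed
    then have "ip (monom 1 (Suc j)) (star_poly ?S) = ip ?S (monom 1 (m - j))"
      by (rule ip_cong_circle)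
    then show ?thesis by (simp only: ip_cnj)
  qed
  have "(1 - \<alpha> m * cnj (\<alpha> m)) * ip (monom 1 j) (szego \<alpha> m) =
      ip (pCons 0 (monom 1 j)) (smult (1 - \<alpha> m * cnj (\<alpha> m)) (pCons 0 (szego \<alpha> m)))"
    by (simp add: ip_smult_right ip_pCons_pCons)
  also have "\<dots> = ip (monom 1 (Suc j)) ?S + cnj (\<alpha> m) * ip (monom 1 (Suc j)) (star_poly ?S)"
    unfolding szego_backward by (simp only: ip_add_right ip_smult_right monom_Suc)
  also have "\<dots> = 0"
    using step unfolding star by (simp del: szego.simps)
  finally show ?case
    using \<alpha>_less[of m] abs_square_less_1[of "norm (\<alpha> m)"]
    unfolding mult_cnj_norm mult_eq_0_iff of_real_eq_0_iff by simp
qed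

lemma bs_orthogonal:
  assumes "m \<le> n" "degree p < m"
  shows "circle_measure.ip (bs_circle n) p (szego \<alpha> m) = 0"
proof -
  interpret circle_measure "bs_circle n" by (rule circle_measure_bs)
  show ?thesis
  proof (rule ip_lower_degree[of "monom 1" m])
    fix j assume "j < m"
    then show "ip (monom 1 j) (szego \<alpha> m) = 0"
      by (rule bs_ip_monom_lower[OF assms(1)])
  qed (use assms(2) in \<open>simp_all add: degree_monom_eq\<close>)
qed

text \<open>The squared norm of Phi_n is \<open>rho2 n\<close> by cancellation against the density,
  and \<open>rho2 n\<close> times the total mass by the norm recursion.\<close>

lemma prob_space_bs_measure: "prob_space (bs_measure n)"
proof -
  interpret circle_measure "bs_circle n" by (rule circle_measure_bs)
  have "ip (szego \<alpha> n) (szego \<alpha> n) = of_real (rho2 n) * ip 1 1"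
    unfolding rho2_def
  proof (rule ip_szego_norm)
    fix m and p :: "complex poly" assume "m < n" "degree p \<le> m"
    then show "ip p (szego \<alpha> (Suc m)) = 0"
      by (intro bs_orthogonal) (auto simp del: szego.simps)
  qed
  then have "ip 1 1 = 1"
    using rho2_pos[of n] by (simp add: bs_ip_szego_self)
  then have "complex_of_real (measure (bs_circle n) UNIV) = of_real 1"
    by (simp add: ip_def scaleR_conv_of_real)
  then have "measure (bs_circle n) UNIV = 1"
    by (simp only: of_real_eq_iff)
  then have "measure (bs_measure n) UNIV = 1"
    by (simp add: measure_distr)
  then show ?thesis
    using finite_bs_measure[of n]
    by (intro prob_spaceI) (simp add: emeasure_eq_ennreal_measure less_top)
qed

lemma bs_measure_interval: "emeasure (bs_measure n) (- {0..2 * pi}) = 0"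
proof -
  have "emeasure (bs_measure n) (- {0..2 * pi}) =
      (\<integral>\<^sup>+t. ennreal (bs_density n t) * indicator (- {0..2 * pi}) t \<partial>dtheta)"
    unfolding bs_measure_def by (subst emeasure_density) auto
  also have "\<dots> = 0"
  proof -
    have "AE t in dtheta. t \<in> {0..2 * pi}"
      unfolding dtheta_def by (rule AE_uniform_measureI) auto
    then have "AE t in dtheta. ennreal (bs_density n t) * indicator (- {0..2 * pi}) t = 0"
      by eventually_elim auto
    then show ?thesis
      by (subst nn_integral_0_iff_AE) auto
  qed
  finally show ?thesis .
qed

lemma tight_bs: "tight bs_measure"
  unfolding tight_def
proof (intro conjI allI impI)
  fix n
  show "real_distribution (bs_measure n)"
    using prob_space_bs_measure[of n] by (simp add: real_distribution_def real_distribution_axioms_def)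
next
  fix e :: real assume e: "e > 0"
  \<comment> \<open>Tightness is phrased with intervals open on the left, hence a left endpoint
    below 0.\<close>
  have "measure (bs_measure n) {-1<..2 * pi} = 1" for n
  proof -
    interpret prob_space "bs_measure n" by (rule prob_space_bs_measure)
    have "AE t in bs_measure n. t \<in> {-1<..2 * pi}"
      using bs_measure_interval[of n] by (intro AE_I[of _ _ "- {0..2 * pi}"]) auto
    then show ?thesis
      by (subst prob_eq_1) auto
  qed
  moreover have "-1 < 2 * pi" using pi_gt_zero by linarith
  ultimately show "\<exists>a b. a < b \<and> (\<forall>n. 1 - e < measure (bs_measure n) {a<..b})"
    using e by (intro exI[of _ "-1"] exI[of _ "2 * pi"]) auto
qed

end

text \<open>By second countability the complement of the support is covered by countably many null
  sets of a base.\<close>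

lemma AE_measure_support:
  assumes "sets M = sets (borel :: complex measure)"
  shows "AE z in M. z \<in> measure_support M"
proof -
  obtain B :: "complex set set" where B: "countable B" "\<And>C. C \<in> B \<Longrightarrow> open C"
    "\<And>S. open S \<Longrightarrow> \<exists>U. U \<subseteq> B \<and> S = \<Union>U"
    using univ_second_countable by metis
  have "- measure_support M \<subseteq> \<Union>{C \<in> B. emeasure M C = 0}"
  proof
    fix x assume "x \<in> - measure_support M"
    then obtain U where U: "open U" "x \<in> U" "emeasure M U = 0"
      by (auto simp: measure_support_def)
    obtain V where V: "V \<subseteq> B" "U = \<Union>V"
      using B(3)[OF U(1)] by blast
    then obtain C where C: "C \<in> V" "x \<in> C" "C \<subseteq> U"
      using U(2) by blast
    have "emeasure M C = 0"
      using emeasure_mono[OF C(3), of M] U(1,3) assms by simp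
    then show "x \<in> \<Union>{C \<in> B. emeasure M C = 0}"
      using C V by blast
  qed
  moreover have "\<Union>{C \<in> B. emeasure M C = 0} \<in> null_sets M"
    using B(1,2) assms
    by (intro null_sets_UN'[of _ "\<lambda>C. C", simplified]) (auto simp: null_sets_def intro: countable_subset)
  ultimately show ?thesis
    by (intro AE_I'[of "\<Union>{C \<in> B. emeasure M C = 0}"]) auto
qed

context verblunsky_seq
begin

theorem verblunsky_exists: "\<exists>\<mu>. verblunsky \<mu> \<alpha>"
proof -
  obtain r M where r: "strict_mono r" and M: "real_distribution M"
    and conv: "weak_conv_m (bs_measure \<circ> id \<circ> r) M"
    using tight_imp_convergent_subsubsequence[OF tight_bs strict_mono_id] by blast
  interpret M: real_distribution M by (fact M)
  define \<mu> where "\<mu> = distr M borel cis"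
  have cisM [measurable]: "cis \<in> measurable M borel"
    by simp
  have prob: "prob_space \<mu>"
    unfolding \<mu>_def by (rule M.prob_space_distr) simp
  have circle: "circle_measure \<mu>"
  proof (intro circle_measure.intro circle_measure_axioms.intro)
    show "finite_measure \<mu>" using prob by (rule prob_space.finite_measure)
    show "sets \<mu> = sets borel" by (simp add: \<mu>_def)
    have "cis -` (- sphere 0 1) = {}" by auto
    then show "emeasure \<mu> (- sphere 0 1) = 0"
      unfolding \<mu>_def by (subst emeasure_distr) auto
  qed
  interpret circle_measure \<mu> by (fact circle)
  \<comment> \<open>A polynomial expression in \<open>cis t\<close> is bounded and continuous on the
    whole line, so weak convergence there passes to inner products on the circle.\<close>
  have ip_limit: "(\<lambda>n. circle_measure.ip (bs_circle (r n)) p q) \<longlonglongrightarrow> ip p q" for p q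
  proof -
    define f where "f = (\<lambda>t. cnj (poly p (cis t)) * poly q (cis t))"
    have cont: "continuous_on UNIV f"
      unfolding f_def by (intro continuous_intros)
    then have fm [measurable]: "f \<in> borel_measurable borel"
      by (rule borel_measurable_continuous_onI)
    have "bounded ((\<lambda>z. cnj (poly p z) * poly q z) ` sphere 0 1)"
      by (intro compact_imp_bounded compact_continuous_image continuous_intros) auto
    then obtain B where B: "\<And>z. norm z = 1 \<Longrightarrow> norm (cnj (poly p z) * poly q z) \<le> B"
      unfolding bounded_iff by (metis image_eqI mem_sphere_0)
    have "(\<lambda>n. integral\<^sup>L ((bs_measure \<circ> id \<circ> r) n) f) \<longlonglongrightarrow> integral\<^sup>L M f"
    proof (rule weak_conv_imp_integral_bdd_continuous_conv[OF _ M conv])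
      show "real_distribution ((bs_measure \<circ> id \<circ> r) n)" for n
        using tight_bs by (simp add: tight_def)
      show "isCont f t" for t
        using cont by (simp add: continuous_on_eq_continuous_at)
      show "norm (f t) \<le> B" for t
        unfolding f_def by (intro B) simp
    qed
    moreover have "circle_measure.ip (bs_circle n) p q = integral\<^sup>L (bs_measure n) f" for n
      unfolding circle_measure.ip_def[OF circle_measure_bs] f_def
      by (rule integral_distr) (auto intro!: borel_measurable_continuous_onI continuous_intros)
    moreover have "ip p q = integral\<^sup>L M f"
      unfolding ip_def f_def unfolding \<mu>_def
      by (rule integral_distr) (auto intro!: borel_measurable_continuous_onI continuous_intros)
    ultimately show ?thesis by simp
  qed
  have orth: "ip p (szego \<alpha> m) = 0" if "degree p < m" for p m
  proof (rule LIMSEQ_unique[OF ip_limit])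
    \<comment> \<open>The measure with index \<open>r n\<close> is orthogonal up to degree
      \<open>r n\<close>, which is at least \<open>n\<close> and so eventually at least
      \<open>m\<close>.\<close>
    have "\<forall>\<^sub>F n in sequentially. circle_measure.ip (bs_circle (r n)) p (szego \<alpha> m) = 0"
      using eventually_ge_at_top[of m]
    proof eventually_elim
      case (elim n)
      then have "m \<le> r n"
        using seq_suble[OF r, of n] by linarith
      then show ?case by (rule bs_orthogonal[OF _ that])
    qed
    then show "(\<lambda>n. circle_measure.ip (bs_circle (r n)) p (szego \<alpha> m)) \<longlonglongrightarrow> 0"
      by (rule tendsto_eventually)
  qed
  have one: "ip 1 1 = 1"
    using prob_space.prob_space[OF prob] by (simp add: ip_def)
  have norm: "ip (szego \<alpha> n) (szego \<alpha> n) = of_real (rho2 n)" for n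
  proof -
    have "ip (szego \<alpha> n) (szego \<alpha> n) = of_real (rho2 n) * ip 1 1"
      unfolding rho2_def
    proof (rule ip_szego_norm)
      fix m and p :: "complex poly" assume "degree p \<le> m"
      then show "ip p (szego \<alpha> (Suc m)) = 0"
        by (intro orth) (auto simp del: szego.simps)
    qed
    then show ?thesis by (simp add: one)
  qed
  have "infinite (measure_support \<mu>)"
  proof
    assume fin: "finite (measure_support \<mu>)"
    \<comment> \<open>A monic polynomial vanishing on a finite support is zero almost everywhere,
      yet its inner product with the Szego polynomial of the same degree is the positive number
      \<open>rho2 N\<close>.\<close>
    define q where "q = (\<Prod>s\<in>measure_support \<mu>. [:- s, 1:])"
    define N where "N = card (measure_support \<mu>)"
    have deg: "degree q = N"
      unfolding q_def N_def by (subst degree_prod_eq_sum_degree) auto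
    have lead: "coeff q N = 1"
      using lead_coeff_prod[of "\<lambda>s. [:- s, 1:]" "measure_support \<mu>"] unfolding deg [symmetric] q_def by simp
    define g where "g = q - szego \<alpha> N"
    have "ip g (szego \<alpha> N) = 0"
    proof (cases "N = 0")
      case True
      have "coeff g i = 0" for i
        using lead deg True by (cases "i = 0") (auto simp: g_def coeff_eq_0)
      then have "g = 0" by (simp add: poly_eq_iff)
      then show ?thesis by simp
    next
      case False
      have "degree g \<le> N"
        using deg by (auto simp: g_def intro: degree_diff_le)
      moreover have "coeff g N = 0"
        using lead by (simp add: g_def)
      ultimately have "degree g < N"
        using False by (metis degree_0 eq_zero_or_degree_less gr0I)
      then show ?thesis by (rule orth)
    qed
    then have "ip q (szego \<alpha> N) = of_real (rho2 N)"
      using ip_add_left[of g "szego \<alpha> N" "szego \<alpha> N"] by (simp add: norm g_def)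
    moreover have "ip q (szego \<alpha> N) = 0"
    proof -
      have "AE z in \<mu>. cnj (poly q z) * poly (szego \<alpha> N) z = 0"
        using AE_measure_support[OF sets_M]
      proof eventually_elim
        case (elim z)
        then have "poly q z = 0"
          using fin by (auto simp: q_def poly_prod)
        then show ?case by simp
      qed
      then show ?thesis
        unfolding ip_def by (rule integral_eq_zero_AE)
    qed
    ultimately show False using rho2_pos[of N] by simp
  qed
  then have "nontrivial_circle_prob \<mu>"
    using prob sets_M null_off_circle by (simp add: nontrivial_circle_prob_def)
  moreover have "monic_orthogonal_polys \<mu> (szego \<alpha>)"
  proof -
    have "ip (szego \<alpha> m) (szego \<alpha> n) = 0" if "m \<noteq> n" for m n
    proof (cases "m < n")
      case True
      then show ?thesis by (intro orth) auto
    next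
      case False
      then have "ip (szego \<alpha> n) (szego \<alpha> m) = 0"
        using that by (intro orth) auto
      then show ?thesis by (metis complex_cnj_zero ip_cnj)
    qed
    then show ?thesis
      by (simp add: monic_orthogonal_polys_def ip_def)
  qed
  ultimately have "verblunsky \<mu> \<alpha>"
    unfolding verblunsky_def by (intro conjI exI[of _ "szego \<alpha>"]) auto
  then show ?thesis ..
qed

end

section \<open>Lebesgue decomposition\<close>

text \<open>Exhaustion: \<open>S\<close> is a countable union of null sets on which \<open>M\<close>
  attains its supremum over null sets; a null set with mass outside \<open>S\<close> would exceed
  that supremum.\<close>

lemma maximal_null_set:
  assumes "finite_measure M" "sets M = sets N"
  obtains S where "S \<in> null_sets N" "\<And>A. A \<in> null_sets N \<Longrightarrow> emeasure M (A - S) = 0"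
proof -
  interpret finite_measure M by (fact assms)
  define \<Sigma> where "\<Sigma> = measure M ` null_sets N"
  have ne: "\<Sigma> \<noteq> {}" and bdd: "bdd_above \<Sigma>"
    using bounded_measure by (auto simp: \<Sigma>_def intro!: bdd_aboveI[of _ "measure M (space M)"])
  have "\<exists>A\<in>null_sets N. measure M A > Sup \<Sigma> - 1 / real (Suc n)" for n
    using less_cSup_iff[OF ne bdd, of "Sup \<Sigma> - 1 / real (Suc n)"] by (auto simp: \<Sigma>_def)
  then obtain A where A: "\<And>n. A n \<in> null_sets N" "\<And>n. measure M (A n) > Sup \<Sigma> - 1 / real (Suc n)"
    by metis
  define S where "S = (\<Union>n. A n)"
  have S: "S \<in> null_sets N"
    unfolding S_def using A(1) by (intro null_sets_UN) auto
  have setsN: "X \<in> sets M" if "X \<in> null_sets N" for X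
    using that assms(2) by auto
  have Sup_le: "Sup \<Sigma> \<le> measure M S"
  proof (rule ccontr)
    assume "\<not> ?thesis"
    then obtain n where "1 / real (Suc n) < Sup \<Sigma> - measure M S"
      using nat_approx_posE[of "Sup \<Sigma> - measure M S"] by auto
    moreover have "measure M (A n) \<le> measure M S"
      using setsN[OF S] by (intro finite_measure_mono) (auto simp: S_def)
    ultimately show False using A(2)[of n] by linarith
  qed
  have "emeasure M (B - S) = 0" if B: "B \<in> null_sets N" for B
  proof -
    have "measure M (S \<union> B) \<le> Sup \<Sigma>"
      using S B by (intro cSup_upper bdd) (auto simp: \<Sigma>_def)
    moreover have "measure M (S \<union> B) = measure M S + measure M (B - S)"
      using setsN[OF S] setsN[OF B] finite_measure_Union[of S "B - S"] by (auto simp: Un_Diff_cancel)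
    ultimately have "measure M (B - S) \<le> 0"
      using Sup_le by linarith
    then have "measure M (B - S) = 0"
      by (simp add: measure_le_0_iff)
    then show ?thesis by (simp add: emeasure_eq_measure)
  qed
  then show ?thesis using S that by blast
qed

text \<open>A Radon-Nikodym density is extended-valued and lives on the circle, whereas
  \<open>ac_circle_measure\<close> takes a real function of the angle; almost everywhere finiteness
  bridges the two.\<close>

lemma ac_circle_measure_eq_density:
  assumes f: "f \<in> borel_measurable borel" and fin: "AE z in distr dtheta borel cis. f z \<noteq> \<infinity>"
  shows "ac_circle_measure (\<lambda>t. enn2real (f (cis t))) = density (distr dtheta borel cis) f"
proof -
  note f [measurable]
  have "AE t in dtheta. f (cis t) \<noteq> \<infinity>"
    using fin by (subst (asm) AE_distr_iff) auto
  then have "AE t in dtheta. ennreal (enn2real (f (cis t))) = f (cis t)"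
    by eventually_elim (simp add: top.not_eq_extremum)
  then have "density dtheta (\<lambda>t. ennreal (enn2real (f (cis t)))) = density dtheta (\<lambda>t. f (cis t))"
    by (intro density_cong) auto
  then show ?thesis
    unfolding ac_circle_measure_def by (subst density_distr) (auto simp: comp_def)
qed

text \<open>The measure is cut along the maximal arc-length null set: the part on \<open>S\<close>
  is singular, the rest charges no null set and has a density.\<close>

theorem lebesgue_decomposition_exists:
  assumes "finite_measure \<mu>" "sets \<mu> = sets borel"
  shows "\<exists>w \<mu>s. lebesgue_decomposition \<mu> w \<mu>s"
proof -
  interpret \<mu>: finite_measure \<mu> by (fact assms)
  interpret dtheta: prob_space dtheta by (rule prob_space_dtheta)
  define \<nu> where "\<nu> = distr dtheta borel cis"
  interpret \<nu>: prob_space \<nu>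
    unfolding \<nu>_def by (rule dtheta.prob_space_distr) simp
  have sets\<nu>: "sets \<nu> = sets borel" by (simp add: \<nu>_def)
  obtain S where S: "S \<in> null_sets \<nu>" "\<And>A. A \<in> null_sets \<nu> \<Longrightarrow> emeasure \<mu> (A - S) = 0"
    using maximal_null_set[OF assms(1), of \<nu>] assms(2) sets\<nu> by metis
  have Sm: "S \<in> sets borel" "S \<in> sets \<mu>"
    using S(1) sets\<nu> assms(2) by auto
  define \<mu>a \<mu>s where "\<mu>a = density \<mu> (indicator (- S))" and "\<mu>s = density \<mu> (indicator S)"
  have sets: "sets \<mu>a = sets borel" "sets \<mu>s = sets borel"
    by (simp_all add: \<mu>a_def \<mu>s_def assms)
  have em: "emeasure \<mu>a A = emeasure \<mu> (A - S)" "emeasure \<mu>s A = emeasure \<mu> (A \<inter> S)" if "A \<in> sets borel" for A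
    using that Sm assms(2)
    by (simp_all add: \<mu>a_def \<mu>s_def emeasure_density Diff_eq Int_commute flip: indicator_inter_arith)
  have "absolutely_continuous \<nu> \<mu>a"
    unfolding absolutely_continuous_def
  proof
    fix A assume A: "A \<in> null_sets \<nu>"
    then show "A \<in> null_sets \<mu>a"
      using S(2)[OF A] em(1)[of A] sets sets\<nu> null_setsD2[OF A] by (intro null_setsI) auto
  qed
  then obtain f where f: "f \<in> borel_measurable \<nu>" "density \<nu> f = \<mu>a"
    using \<nu>.Radon_Nikodym[of \<mu>a] sets sets\<nu> by auto
  have fm: "f \<in> borel_measurable borel"
    using f(1) measurable_cong_sets[OF sets\<nu> refl] by blast
  have "(\<integral>\<^sup>+z. f z \<partial>\<nu>) = emeasure \<mu>a UNIV"
    unfolding f(2) [symmetric] using f(1) by (subst emeasure_density) (auto simp: sets\<nu>)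
  also have "\<dots> \<noteq> \<infinity>"
    by (simp add: em \<mu>.emeasure_finite)
  finally have "AE z in \<nu>. f z \<noteq> \<infinity>"
    by (intro nn_integral_PInf_AE f(1)) auto
  then have ac: "ac_circle_measure (\<lambda>t. enn2real (f (cis t))) = \<mu>a"
    unfolding f(2) [symmetric] \<nu>_def by (intro ac_circle_measure_eq_density fm)
  have "lebesgue_decomposition \<mu> (\<lambda>t. enn2real (f (cis t))) \<mu>s"
    unfolding lebesgue_decomposition_def ac \<nu>_def [symmetric]
  proof (intro conjI ballI allI bexI[of _ S])
    show "(\<lambda>t. enn2real (f (cis t))) \<in> borel_measurable borel"
      using fm by measurable
    show "emeasure \<mu> A = emeasure \<mu>a A + emeasure \<mu>s A" if "A \<in> sets borel" for A
    proof -
      have "(A - S) \<inter> (A \<inter> S) = {}" by auto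
      then show ?thesis
        using that Sm assms(2) plus_emeasure[of "A - S" \<mu> "A \<inter> S"] by (simp add: em Un_Diff_Int)
    qed
    show "emeasure \<nu> S = 0"
      using S(1) by auto
    show "emeasure \<mu>s (- S) = 0"
      using Sm by (simp add: em)
  qed (use sets Sm in auto)
  then show ?thesis by blast
qed

section \<open>The counterexample\<close>

lemma summable_decseq_diff:
  fixes x :: "nat \<Rightarrow> real"
  assumes "decseq x" "\<And>n. x n \<ge> 0"
  shows "summable (\<lambda>n. x n - x (Suc n))"
proof (rule bounded_imp_summable)
  show "x n - x (Suc n) \<ge> 0" for n
    using decseq_SucD[OF assms(1), of n] by simp
  show "(\<Sum>k\<le>n. x k - x (Suc k)) \<le> x 0" for n
    using sum_lessThan_telescope'[of x "Suc n"] assms(2)[of "Suc n"] by (simp add: lessThan_Suc_atMost)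
qed

lemma shift_minus_in_ell:
  assumes "\<beta> \<in> ell 2"
  shows "shift_minus z \<beta> \<in> ell 2"
proof -
  have s: "summable (\<lambda>n. norm (\<beta> n) ^ 2)"
    using assms by (simp add: ell_def)
  have "summable (\<lambda>n. 2 * norm (\<beta> (Suc n)) ^ 2 + 2 * (norm z ^ 2 * norm (\<beta> n) ^ 2))"
    using s by (intro summable_add summable_mult) (simp_all only: summable_Suc_iff[of "\<lambda>n. norm (\<beta> n) ^ 2"])
  moreover have "norm (shift_minus z \<beta> n) ^ 2 \<le> 2 * norm (\<beta> (Suc n)) ^ 2 + 2 * (norm z ^ 2 * norm (\<beta> n) ^ 2)" for n
  proof -
    have "norm (shift_minus z \<beta> n) \<le> norm (\<beta> (Suc n)) + norm z * norm (\<beta> n)"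
      unfolding shift_minus_def shift_def using norm_triangle_ineq4[of "\<beta> (Suc n)" "z * \<beta> n"]
      by (simp add: norm_mult)
    then have "norm (shift_minus z \<beta> n) ^ 2 \<le> (norm (\<beta> (Suc n)) + norm z * norm (\<beta> n)) ^ 2"
      by (intro power_mono) auto
    also have "\<dots> \<le> 2 * norm (\<beta> (Suc n)) ^ 2 + 2 * (norm z * norm (\<beta> n)) ^ 2"
      using sum_squares_bound[of "norm (\<beta> (Suc n))" "norm z * norm (\<beta> n)"]
      by (simp add: power2_sum)
    finally show ?thesis by (simp add: power_mult_distrib)
  qed
  ultimately show ?thesis
    unfolding ell_def by (auto intro: summable_comparison_test')
qed

text \<open>\<open>shift_minus z\<close> maps \<open>ell 2\<close> to itself, so a single
  application landing there settles the cube.\<close>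

lemma shift_minus_cube_in_ell:
  "shift_minus z \<beta> \<in> ell 2 \<Longrightarrow> (shift_minus z ^^ 3) \<beta> \<in> ell 2"
  by (simp add: numeral_3_eq_3 shift_minus_in_ell)

text \<open>The factor z^n turns S - z into a plain difference times a number of modulus 1. The
  increments of a bounded monotone sequence are summable and bounded, hence square summable.\<close>

lemma modulated_decseq_in_ell:
  fixes x :: "nat \<Rightarrow> real"
  assumes x: "decseq x" "\<And>n. x n \<ge> 0" and z: "norm z = 1"
  shows "(shift_minus z ^^ 3) (\<lambda>n. of_real (x n) * z ^ n) \<in> ell 2"
proof (rule shift_minus_cube_in_ell)
  define d where "d = (\<lambda>n. x n - x (Suc n))"
  have d: "summable d"
    unfolding d_def by (rule summable_decseq_diff[OF x])
  have d0: "d n \<ge> 0" "d n \<le> x 0" for n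
    using decseq_SucD[OF x(1), of n] decseqD[OF x(1), of 0 n] x(2)[of "Suc n"] by (auto simp: d_def)
  have "norm (shift_minus z (\<lambda>n. of_real (x n) * z ^ n) n) = d n" for n
  proof -
    have "shift_minus z (\<lambda>n. of_real (x n) * z ^ n) n = of_real (- d n) * z ^ Suc n"
      by (simp add: shift_minus_def shift_def d_def algebra_simps)
    then show ?thesis
      using d0(1)[of n] z by (simp only: norm_mult norm_power norm_of_real) simp
  qed
  moreover have "summable (\<lambda>n. d n ^ 2)"
  proof (rule summable_comparison_test')
    show "summable (\<lambda>n. x 0 * d n)" using d by (rule summable_mult)
    show "norm (d n ^ 2) \<le> x 0 * d n" for n
      using d0[of n] by (simp add: power2_eq_square mult_right_mono)
  qed
  ultimately show "shift_minus z (\<lambda>n. of_real (x n) * z ^ n) \<in> ell 2"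
    by (simp add: ell_def)
qed

lemma summable_shifted_powr_iff:
  "summable (\<lambda>n. real (n + 1) powr s) \<longleftrightarrow> s < -1"
  using summable_Suc_iff[of "\<lambda>n. real n powr s"] summable_real_powr_iff[of s] by simp

locale counterexample =
  fixes c :: real and \<alpha> :: "nat \<Rightarrow> complex"
  assumes c: "0 < c" "c < 1 / 2"
    and \<alpha>: "\<And>n. \<alpha> n = complex_of_real (c * real (n + 1) powr (- 3 / 20)) * (1 + (- \<i>) ^ n)"
begin

definition A :: "nat \<Rightarrow> real" where
  "A n = c * real (n + 1) powr (- 3 / 20)"

lemma A_pos: "A n > 0"
  using c by (simp add: A_def)

lemma decseq_A: "decseq A"
  unfolding decseq_def A_def using c by (intro allI impI mult_left_mono powr_mono2') auto

lemma A_power: "A n ^ k = c ^ k * real (n + 1) powr (- 3 / 20 * real k)"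
  unfolding A_def power_mult_distrib by (subst powr_power) (auto simp: mult.commute)

text \<open>The modulus of 1 + (-i)^n reaches 2 at multiples of four, which is where c < 1/2 is
  used.\<close>

lemma norm_\<alpha>_less: "norm (\<alpha> n) < 1"
proof -
  have "A n < 1 / 2"
  proof -
    have "A n \<le> A 0" by (rule decseqD[OF decseq_A]) simp
    also have "A 0 = c" by (simp add: A_def)
    finally show ?thesis using c by simp
  qed
  moreover have "norm (1 + (- \<i>) ^ n) \<le> 2"
    using norm_triangle_ineq[of 1 "(- \<i>) ^ n"] by (simp add: norm_power)
  ultimately have "A n * norm (1 + (- \<i>) ^ n) < 1"
    using mult_left_mono[of "norm (1 + (- \<i>) ^ n)" 2 "A n"] A_pos[of n] by linarith
  then show ?thesis
    using A_pos[of n] unfolding \<alpha> A_def [symmetric] norm_mult by simp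
qed

lemma summable_A8: "summable (\<lambda>n. A n ^ 8)"
  unfolding A_power by (intro summable_mult summable_shifted_powr_iff[THEN iffD2]) simp

lemma decseq_A4: "decseq (\<lambda>k. A (4 * k))"
  using decseq_A by (simp add: decseq_def)

lemma summable_A4_diff: "summable (\<lambda>k. A (4 * k) - A (4 * Suc k))"
  by (rule summable_decseq_diff[OF decseq_A4 less_imp_le[OF A_pos]])

text \<open>The exponent is 6 * 3/20 = 9/10 < 1; thinning out by four costs a constant only, since 4
  k + 1 <= 4 (k + 1).\<close>

lemma A4_not_summable: "\<not> summable (\<lambda>k. A (4 * k) ^ 6)"
proof
  assume s: "summable (\<lambda>k. A (4 * k) ^ 6)"
  have "summable (\<lambda>k. (c ^ 6 * 4 powr (- 9 / 10)) * real (k + 1) powr (- 9 / 10))"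
  proof (rule summable_comparison_test'[OF s])
    fix k
    have "4 powr (- 9 / 10) * real (k + 1) powr (- 9 / 10) = (4 * real (k + 1)) powr (- 9 / 10)"
      by (subst powr_mult) auto
    also have "\<dots> \<le> real (4 * k + 1) powr (- 9 / 10)"
      by (intro powr_mono2') auto
    finally show "norm ((c ^ 6 * 4 powr (- 9 / 10)) * real (k + 1) powr (- 9 / 10)) \<le> A (4 * k) ^ 6"
      using c unfolding A_power by (simp add: abs_mult)
  qed
  then have "summable (\<lambda>k. real (k + 1) powr (- 9 / 10))"
    by (rule summable_mult_D) (use c in auto)
  then show False
    unfolding summable_shifted_powr_iff by simp
qed

lemma resonant_\<alpha>: "szego_resonant \<alpha> (\<lambda>k. A (4 * k))"
proof (intro szego_resonant.intro resonant.intro szego_fps_szego resonant_axioms.intro szego_resonant_axioms.intro)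
  show "cnj (complex_of_real (A (4 * k))) = complex_of_real (A (4 * k))" for k
    by simp
  have "Bseq (\<lambda>k. complex_of_real (A (4 * k)))"
    using decseqD[OF decseq_A, of 0] A_pos by (intro BseqI'[of _ "A 0"]) (simp add: abs_of_pos)
  moreover have "l1 (\<lambda>k. complex_of_real (A (4 * Suc k)) - complex_of_real (A (4 * k)))"
  proof -
    have "norm (complex_of_real (A (4 * Suc k)) - complex_of_real (A (4 * k))) = A (4 * k) - A (4 * Suc k)" for k
      using decseqD[OF decseq_A4, of k "Suc k"]
      by (simp only: of_real_diff [symmetric] norm_of_real) simp
    then show ?thesis
      unfolding l1_def using summable_A4_diff by simp
  qed
  ultimately show "bv (\<lambda>k. complex_of_real (A (4 * k)))"
    by (simp add: bv_def)
  show "l1 (\<lambda>k. complex_of_real (A (4 * k)) ^ 8)"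
    unfolding l1_def
  proof (rule summable_comparison_test'[OF summable_A8])
    fix k
    have "A (4 * k) ^ 8 \<le> A k ^ 8"
      using decseqD[OF decseq_A, of k "4 * k"] A_pos by (intro power_mono) (auto simp: less_imp_le)
    then show "norm (norm (complex_of_real (A (4 * k)) ^ 8)) \<le> A k ^ 8"
      using A_pos by (simp add: norm_power abs_of_pos)
  qed
  show "l1 (\<lambda>k. \<alpha> (4 * k + i) - (1 + (- \<i>) ^ i) * complex_of_real (A (4 * k)))" if i: "i < 4" for i
  proof -
    \<comment> \<open>Within a block \<open>A\<close> changes by no more than its drop over the
      whole block, and these drops telescope.\<close>
    have "l1 (\<lambda>k. (1 + (- \<i>) ^ i) * complex_of_real (A (4 * k + i) - A (4 * k)))"
    proof (rule l1_cmult, unfold l1_def, rule summable_comparison_test'[OF summable_A4_diff])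
      fix k
      have "A (4 * Suc k) \<le> A (4 * k + i)" "A (4 * k + i) \<le> A (4 * k)"
        using i by (auto intro!: decseqD[OF decseq_A])
      then show "norm (norm (complex_of_real (A (4 * k + i) - A (4 * k)))) \<le> A (4 * k) - A (4 * Suc k)"
        by (simp only: norm_of_real) simp
    qed
    moreover have "\<alpha> (4 * k + i) - (1 + (- \<i>) ^ i) * complex_of_real (A (4 * k)) =
        (1 + (- \<i>) ^ i) * complex_of_real (A (4 * k + i) - A (4 * k))" for k
    proof -
      have "(- \<i>) ^ 4 = 1" by (simp add: eval_nat_numeral)
      then have "(- \<i>) ^ (4 * k + i) = (- \<i>) ^ i"
        by (simp add: power_add power_mult)
      then show ?thesis
        unfolding \<alpha> A_def [symmetric] by (simp add: algebra_simps)
    qed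
    ultimately show ?thesis by (simp only:)
  qed
  show "norm (\<alpha> k) < 1" for k by (rule norm_\<alpha>_less)
  show "\<not> summable (\<lambda>k. A (4 * k) ^ 6)" by (rule A4_not_summable)
qed

lemma modulated_in_ell_8:
  assumes "norm z = 1"
  shows "(\<lambda>n. complex_of_real (A n) * z ^ n) \<in> ell 8"
  using assms summable_A8 A_pos by (simp add: ell_def norm_mult norm_power abs_of_pos)

lemma modulated_difference:
  assumes "norm z = 1"
  shows "(shift_minus z ^^ 3) (\<lambda>n. complex_of_real (A n) * z ^ n) \<in> ell 2"
  by (rule modulated_decseq_in_ell[OF decseq_A less_imp_le[OF A_pos] assms])

lemma decomposition:
  "\<exists>\<beta>1 \<beta>2. (\<forall>n. \<alpha> n = \<beta>1 n + \<beta>2 n) \<and>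
     (shift_minus 1 ^^ 3) \<beta>1 \<in> ell 2 \<and> (shift_minus (- \<i>) ^^ 3) \<beta>2 \<in> ell 2 \<and>
     \<beta>1 \<in> ell 8 \<and> \<beta>2 \<in> ell 8"
  using modulated_difference[of 1] modulated_difference[of "- \<i>"] modulated_in_ell_8[of 1] modulated_in_ell_8[of "- \<i>"]
  by (intro exI[of _ "\<lambda>n. complex_of_real (A n) * 1 ^ n"] exI[of _ "\<lambda>n. complex_of_real (A n) * (- \<i>) ^ n"])
     (auto simp: \<alpha> A_def ring_distribs)

lemma decomposition_condition_D:
  assumes "\<theta> 1 = 0" "\<theta> 2 = pi / 2" "m 1 = 3" "m 2 = 3"
  shows "condition_D 2 \<theta> m \<alpha>"
proof -
  obtain \<beta>1 \<beta>2 where \<beta>: "\<And>n. \<alpha> n = \<beta>1 n + \<beta>2 n" "(shift_minus 1 ^^ 3) \<beta>1 \<in> ell 2"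
     "(shift_minus (- \<i>) ^^ 3) \<beta>2 \<in> ell 2" "\<beta>1 \<in> ell 8" "\<beta>2 \<in> ell 8"
    using decomposition by blast
  have "{1..2} = {1, 2::nat}" by auto
  moreover have "cis (- \<theta> 2) = - \<i>" "cis (- \<theta> 1) = 1"
    unfolding assms using cis_minus_pi_half by simp_all
  ultimately show ?thesis
    unfolding condition_D_def using \<beta> assms(3,4)
    by (intro exI[of _ "\<lambda>j. if j = 1 then \<beta>1 else \<beta>2"]) simp
qed

lemma trig_weight_eq:
  assumes "\<theta> 1 = 0" "\<theta> 2 = pi / 2" "m 1 = 3" "m 2 = 3"
  shows "trig_weight 2 \<theta> m = entropy_weight"
proof
  fix t
  have "{1..2} = {1, 2::nat}" by auto
  moreover have "cos (t - pi / 2) = sin t"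
    by (simp add: cos_diff)
  ultimately show "trig_weight 2 \<theta> m t = entropy_weight t"
    unfolding trig_weight_def entropy_weight_def by (simp add: assms del: One_nat_def)
qed

text \<open>Keeps the claim about all measures with these coefficients from being vacuous and
  supplies the instance that refutes the general implication.\<close>

lemma measure_exists: "\<exists>\<mu> w \<mu>s. verblunsky \<mu> \<alpha> \<and> lebesgue_decomposition \<mu> w \<mu>s"
proof -
  interpret verblunsky_seq \<alpha>
    by unfold_locales (rule norm_\<alpha>_less)
  obtain \<mu> where \<mu>: "verblunsky \<mu> \<alpha>"
    using verblunsky_exists by blast
  then interpret circle_measure \<mu>
    by (rule verblunsky_circle_measure)
  show ?thesis
    using \<mu> lebesgue_decomposition_exists[OF finite_measure_axioms sets_M] by blast
qed

end

lemma counterexample_main: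
  fixes c :: real and \<alpha> :: "nat \<Rightarrow> complex" and \<theta> :: "nat \<Rightarrow> real" and m :: "nat \<Rightarrow> nat"
  assumes "0 < c" "c < 1 / 2"
    and \<alpha>: "\<forall>n. \<alpha> n = complex_of_real (c * real (n + 1) powr (- 3 / 20)) * (1 + (- \<i>) ^ n)"
    and data: "\<theta> 1 = 0" "\<theta> 2 = pi / 2" "m 1 = 3" "m 2 = 3"
  shows "(\<exists>\<mu> w \<mu>s. verblunsky \<mu> \<alpha> \<and> lebesgue_decomposition \<mu> w \<mu>s) \<and>
    (\<exists>\<beta>1 \<beta>2.
       (\<forall>n. \<alpha> n = \<beta>1 n + \<beta>2 n) \<and>
       (shift_minus 1 ^^ 3) \<beta>1 \<in> ell 2 \<and> (shift_minus (- \<i>) ^^ 3) \<beta>2 \<in> ell 2 \<and>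
       \<beta>1 \<in> ell 8 \<and> \<beta>2 \<in> ell 8) \<and>
    condition_D 2 \<theta> m \<alpha> \<and>
    (\<forall>\<mu> w \<mu>s. verblunsky \<mu> \<alpha> \<longrightarrow> lebesgue_decomposition \<mu> w \<mu>s \<longrightarrow>
       entropy_integral (\<lambda>t. (1 - cos t) ^ 3 * (1 - sin t) ^ 3) w = -\<infinity> \<and>
       \<not> condition_E 2 \<theta> m w)"
proof -
  interpret counterexample c \<alpha>
    using assms by unfold_locales auto
  interpret szego_resonant \<alpha> "\<lambda>k. A (4 * k)"
    by (rule resonant_\<alpha>)
  show ?thesis
  proof (intro conjI allI impI measure_exists decomposition decomposition_condition_D data)
    fix \<mu> w \<mu>s assume "verblunsky \<mu> \<alpha>" "lebesgue_decomposition \<mu> w \<mu>s"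
    then have "entropy_integral entropy_weight w = - \<infinity>"
      by (rule entropy_integral_eq_minus_infinity)
    then show "entropy_integral (\<lambda>t. (1 - cos t) ^ 3 * (1 - sin t) ^ 3) w = -\<infinity>"
      "\<not> condition_E 2 \<theta> m w"
      unfolding condition_E_def trig_weight_eq[OF data] entropy_weight_def [abs_def] by simp_all
  qed
qed

theorem theorem1p1:
  shows
    "\<not> (\<forall>K \<theta> m \<alpha> \<mu> w \<mu>s.
          admissible_data K \<theta> m \<longrightarrow> verblunsky \<mu> \<alpha> \<longrightarrow> lebesgue_decomposition \<mu> w \<mu>s \<longrightarrow>
          condition_D K \<theta> m \<alpha> \<longrightarrow> condition_E K \<theta> m w) \<and>
     (\<forall>(c::real) (\<alpha> :: nat \<Rightarrow> complex) (\<theta> :: nat \<Rightarrow> real) (m :: nat \<Rightarrow> nat).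
        0 < c \<longrightarrow> c < 1 / 2 \<longrightarrow>
        (\<forall>n. \<alpha> n = complex_of_real (c * real (n + 1) powr (- 3 / 20)) * (1 + (- \<i>) ^ n)) \<longrightarrow>
        \<theta> 1 = 0 \<longrightarrow> \<theta> 2 = pi / 2 \<longrightarrow> m 1 = 3 \<longrightarrow> m 2 = 3 \<longrightarrow>
          (\<exists>\<mu> w \<mu>s. verblunsky \<mu> \<alpha> \<and> lebesgue_decomposition \<mu> w \<mu>s) \<and>
          (\<exists>\<beta>1 \<beta>2.
             (\<forall>n. \<alpha> n = \<beta>1 n + \<beta>2 n) \<and>
             (shift_minus 1 ^^ 3) \<beta>1 \<in> ell 2 \<and> (shift_minus (- \<i>) ^^ 3) \<beta>2 \<in> ell 2 \<and>
             \<beta>1 \<in> ell 8 \<and> \<beta>2 \<in> ell 8) \<and>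
          condition_D 2 \<theta> m \<alpha> \<and>
          (\<forall>\<mu> w \<mu>s. verblunsky \<mu> \<alpha> \<longrightarrow> lebesgue_decomposition \<mu> w \<mu>s \<longrightarrow>
             entropy_integral (\<lambda>t. (1 - cos t) ^ 3 * (1 - sin t) ^ 3) w = -\<infinity> \<and>
             \<not> condition_E 2 \<theta> m w))"
proof (rule conjI)
  show "\<not> (\<forall>K \<theta> m \<alpha> \<mu> w \<mu>s.
          admissible_data K \<theta> m \<longrightarrow> verblunsky \<mu> \<alpha> \<longrightarrow> lebesgue_decomposition \<mu> w \<mu>s \<longrightarrow>
          condition_D K \<theta> m \<alpha> \<longrightarrow> condition_E K \<theta> m w)"
  proof
    assume *: "\<forall>K \<theta> m \<alpha> \<mu> w \<mu>s.
          admissible_data K \<theta> m \<longrightarrow> verblunsky \<mu> \<alpha> \<longrightarrow> lebesgue_decomposition \<mu> w \<mu>s \<longrightarrow>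
          condition_D K \<theta> m \<alpha> \<longrightarrow> condition_E K \<theta> m w"
    define \<theta> :: "nat \<Rightarrow> real" where "\<theta> = (\<lambda>j. if j = 1 then 0 else pi / 2)"
    define m :: "nat \<Rightarrow> nat" where "m = (\<lambda>_. 3)"
    \<comment> \<open>The amplitude 1/4 is one choice of c in the open interval from 0 to
      1/2.\<close>
    define \<alpha> where "\<alpha> = (\<lambda>n. complex_of_real (1 / 4 * real (n + 1) powr (- 3 / 20)) * (1 + (- \<i>) ^ n))"
    have data: "\<theta> 1 = 0" "\<theta> 2 = pi / 2" "m 1 = 3" "m 2 = 3"
      by (simp_all add: \<theta>_def m_def)
    have "{1..2} = {1, 2::nat}" by auto
    then have "admissible_data 2 \<theta> m"
      by (simp add: admissible_data_def \<theta>_def m_def complex_eq_iff)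
    moreover note counterexample_main[of "1 / 4" \<alpha> \<theta> m, OF _ _ _ data]
    ultimately show False using * by (auto simp: \<alpha>_def)
  qed
qed (intro allI impI, rule counterexample_main)

end
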